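(* Let $(X,R)$ be a circularly ordered set with its interval topology, with Novák regular completion $\nu:X\to(\mathcal X_r,\mathcal R)$, $\nu(x)=\ \leq_x$. Let $i_Y:(X,R)\to(Y,R_Y)$ be any proper circularly ordered compactification. Then there exists a unique continuous circular order preserving (COP) surjection $\Psi:Y\to(\mathcal X_r,\mathcal R)$ such that $\Psi\circ i_Y=\nu$.
   Context: A circular order on a set $X$ is a ternary relation $R\subseteq X^3$ (write $[a,b,c]$ for $(a,b,c)\in R$) satisfying: cyclicity ($[a,b,c]\Rightarrow[b,c,a]$); asymmetry ($[a,b,c]\Rightarrow (c,b,a)\notin R$); transitivity ($[a,b,c]$ and $[a,c,d]$ imply $[a,b,d]$); totality (if $a,b,c$ are distinct then $[a,b,c]$ or $[a,c,b]$). Put $(a,b)_R:=\{x\in X:[a,x,b]\}$ and $[a,b]_R:=(a,b)_R\cup\{a,b\}$. The interval topology $\lambda_R$ is the topology on $X$ with base $\{X\setminus[a,b]_R: a,b\in X\}\cup\{X\}$. Circularly ordered sets are topologized by their interval topologies. A map $f:X_1\to X_2$ of circularly ordered sets is COP if: (COP1) whenever $[a,b,c]$ in $X_1$ and $f(a),f(b),f(c)$ are pairwise distinct, then $[f(a),f(b),f(c)]$ in $X_2$; (COP2) if $f(x)=f(y)$ then $f$ is constant on one of the closed intervals $[x,y]$, $[y,x]$. A proper circularly ordered compactification of $(X,R)$ is a map $i_Y:X\to Y$ into a circularly ordered set $(Y,R_Y)$ whose interval topology is compact, such that $i_Y$ has dense image, is a topological embedding for the interval topologies, and is an embedding of circular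 orders ($[a,b,c]_R\iff[i_Y(a),i_Y(b),i_Y(c)]_{R_Y}$). Novák's regular completion. A cut on $(X,R)$ is a linear order $\leq$ on the set $X$ such that $a<b<c$ implies $[a,b,c]$. A gap is a cut having neither a least nor a greatest element. For $x\in X$ the lower point-cut $\leq_x$ is the linear order with least element $x$ and $a<_x b\iff[x,a,b]$ for $a,b\neq x$. A regular cut is either a gap or a lower point-cut; $\mathcal X_r$ is the set of all regular cuts. For distinct $L_1,L_2,L_3\in\mathcal X_r$ put $[L_1,L_2,L_3]_{\mathcal R}$ iff there is a partition $X=A\sqcup B\sqcup D$ into nonempty pieces such that $(X,L_1)=A\oplus B\oplus D$, $(X,L_2)=B\oplus D\oplus A$, $(X,L_3)=D\oplus A\oplus B$, where $\oplus$ denotes the ordinal sum of linearly ordered sets (the same order on each piece being used in all three sums). It is known that $\mathcal R$ is a circular order with compact interval topology and that $\nu$ is itself a proper circularly ordered compactification. *)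

theory Defs
  imports "HOL-Analysis.Analysis"
begin

section \<open>Circular orders and their interval topologies\<close>

definition circular_order_on :: "'a set \<Rightarrow> ('a \<times> 'a \<times> 'a) set \<Rightarrow> bool" where
  "circular_order_on X R \<longleftrightarrow>
     R \<subseteq> X \<times> X \<times> X \<and>
     (\<forall>a b c. (a, b, c) \<in> R \<longrightarrow> (b, c, a) \<in> R) \<and>
     (\<forall>a b c. (a, b, c) \<in> R \<longrightarrow> (c, b, a) \<notin> R) \<and>
     (\<forall>a b c d. (a, b, c) \<in> R \<and> (a, c, d) \<in> R \<longrightarrow> (a, b, d) \<in> R) \<and>
     (\<forall>a\<in>X. \<forall>b\<in>X. \<forall>c\<in>X. a \<noteq> b \<and> b \<noteq> c \<and> a \<noteq> c \<longrightarrow> (a, b, c) \<in> R \<or> (a, c, b) \<in> R)"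

definition circ_open_interval :: "('a \<times> 'a \<times> 'a) set \<Rightarrow> 'a \<Rightarrow> 'a \<Rightarrow> 'a set" where
  "circ_open_interval R a b = {x. (a, x, b) \<in> R}"

definition circ_closed_interval :: "('a \<times> 'a \<times> 'a) set \<Rightarrow> 'a \<Rightarrow> 'a \<Rightarrow> 'a set" where
  "circ_closed_interval R a b = circ_open_interval R a b \<union> {a, b}"

definition interval_base :: "'a set \<Rightarrow> ('a \<times> 'a \<times> 'a) set \<Rightarrow> 'a set set" where
  "interval_base X R = {X - circ_closed_interval R a b |a b. a \<in> X \<and> b \<in> X} \<union> {X}"

text \<open>The library's generated topology treats the family as a subbase; the lemma
  \<open>openin_interval_topology\<close> below shows that for a circular order the family is a base.\<close>

definition interval_topology :: "'a set \<Rightarrow> ('a \<times> 'a \<times> 'a) set \<Rightarrow> 'a topology" where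
  "interval_topology X R = topology_generated_by (interval_base X R)"

lemma topspace_interval_topology [simp]: "topspace (interval_topology X R) = X"
  by (auto simp: interval_topology_def topology_generated_by_topspace interval_base_def)

lemma circ_closed_intervals_merge:
  assumes R: "circular_order_on X R" and X: "a \<in> X" "b \<in> X" "c \<in> X" "d \<in> X" "x \<in> X"
    and x: "x \<notin> circ_closed_interval R a b" "x \<notin> circ_closed_interval R c d"
  shows "\<exists>e\<in>X. \<exists>f\<in>X. x \<notin> circ_closed_interval R e f \<and>
    circ_closed_interval R a b \<union> circ_closed_interval R c d \<subseteq> circ_closed_interval R e f"
proof -
  have cyc: "(v, w, u) \<in> R" if "(u, v, w) \<in> R" for u v w
    using R[unfolded circular_order_on_def, THEN conjunct2, THEN conjunct1] that by blast
  have asym: "(w, v, u) \<notin> R" if "(u, v, w) \<in> R" for u v w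
    using R[unfolded circular_order_on_def, THEN conjunct2, THEN conjunct2, THEN conjunct1] that by blast
  have trans: "(u, v, z) \<in> R" if "(u, v, w) \<in> R" "(u, w, z) \<in> R" for u v w z
    using R[unfolded circular_order_on_def, THEN conjunct2, THEN conjunct2, THEN conjunct2, THEN conjunct1] that by blast
  have total: "(u, v, w) \<in> R \<or> (u, w, v) \<in> R"
    if "u \<in> X" "v \<in> X" "w \<in> X" "u \<noteq> v" "v \<noteq> w" "u \<noteq> w" for u v w
    using R[unfolded circular_order_on_def, THEN conjunct2, THEN conjunct2, THEN conjunct2, THEN conjunct2] that by blast
  have sub: "R \<subseteq> X \<times> X \<times> X"
    using R[unfolded circular_order_on_def, THEN conjunct1] .
  define le where "le u v \<longleftrightarrow> u = v \<or> (x, u, v) \<in> R" for u v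
  have le_total: "le u v \<or> le v u" if "u \<in> X - {x}" "v \<in> X - {x}" for u v
    using total[of x u v] that X by (auto simp: le_def)
  have le_trans: "le u w" if "le u v" "le v w" for u v w
    using trans that unfolding le_def by metis
  have closed_iff: "x \<notin> circ_closed_interval R u v \<and> y \<in> circ_closed_interval R u v \<longleftrightarrow>
      y \<in> X - {x} \<and> le u y \<and> le y v" if "u \<in> X - {x}" "v \<in> X - {x}" "le u v" for u v y
  proof -
    have "x \<notin> circ_closed_interval R u v"
    proof
      assume "x \<in> circ_closed_interval R u v"
      then have r: "(u, x, v) \<in> R"
        using that unfolding circ_closed_interval_def circ_open_interval_def by blast
      show False
        using that(3) asym[OF r] r asym[OF cyc[OF cyc[OF r]]] unfolding le_def by blast
    qed
    moreover have "y \<in> circ_closed_interval R u v \<longleftrightarrow> y \<in> X - {x} \<and> le u y \<and> le y v"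
    proof
      assume y: "y \<in> circ_closed_interval R u v"
      show "y \<in> X - {x} \<and> le u y \<and> le y v"
      proof (cases "y = u \<or> y = v")
        case True
        then show ?thesis using that unfolding le_def by blast
      next
        case False
        then have r: "(u, y, v) \<in> R"
          using y unfolding circ_closed_interval_def circ_open_interval_def by blast
        then have "u \<noteq> v" using asym[OF r] by auto
        then have xuv: "(x, u, v) \<in> R" using that unfolding le_def by blast
        have "(u, y, x) \<in> R" using trans[OF r cyc[OF xuv]] .
        then have xuy: "(x, u, y) \<in> R" using cyc by metis
        have "(v, x, y) \<in> R"
          using trans[OF cyc[OF cyc[OF xuv]] cyc[OF cyc[OF r]]] by blast
        then have "(x, y, v) \<in> R" by (rule cyc)
        moreover have "y \<noteq> x" using asym[OF xuy] xuy by auto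
        moreover have "y \<in> X" using r sub by blast
        ultimately show ?thesis using xuy unfolding le_def by blast
      qed
    next
      assume y: "y \<in> X - {x} \<and> le u y \<and> le y v"
      show "y \<in> circ_closed_interval R u v"
      proof (cases "y = u \<or> y = v")
        case True
        then show ?thesis unfolding circ_closed_interval_def by blast
      next
        case False
        then have r: "(x, u, y) \<in> R" "(x, y, v) \<in> R" using y unfolding le_def by blast+
        have "(y, v, u) \<in> R"
          using trans[OF cyc[OF r(2)] cyc[OF cyc[OF r(1)]]] .
        then have "(u, y, v) \<in> R" using cyc by metis
        then show ?thesis unfolding circ_closed_interval_def circ_open_interval_def by blast
      qed
    qed
    ultimately show ?thesis by blast
  qed
  have ends: "u \<in> X - {x} \<and> v \<in> X - {x} \<and> le u v"
    if "u \<in> X" "v \<in> X" "x \<notin> circ_closed_interval R u v" for u v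
    using that total[of x u v] X cyc[of x v u] cyc[of v u x]
    unfolding circ_closed_interval_def circ_open_interval_def le_def by auto
  have ab: "a \<in> X - {x}" "b \<in> X - {x}" "le a b" and cd: "c \<in> X - {x}" "d \<in> X - {x}" "le c d"
    using ends X x by blast+
  obtain e where e: "e \<in> {a, c}" "le e a" "le e c"
    using le_total[OF ab(1) cd(1)] unfolding le_def by blast
  obtain f where f: "f \<in> {b, d}" "le b f" "le d f"
    using le_total[OF ab(2) cd(2)] unfolding le_def by blast
  have ef: "e \<in> X - {x}" "f \<in> X - {x}" "le e f"
    using e(1) f(1) ab cd le_trans[OF le_trans[OF e(2) ab(3)] f(2)] by auto
  have xef: "x \<notin> circ_closed_interval R e f"
    using closed_iff[OF ef, of e] ef unfolding le_def by blast
  moreover have "circ_closed_interval R a b \<subseteq> circ_closed_interval R e f"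
    using closed_iff[OF ab] closed_iff[OF ef] x e f by (meson le_trans subsetI)
  moreover have "circ_closed_interval R c d \<subseteq> circ_closed_interval R e f"
    using closed_iff[OF cd] closed_iff[OF ef] x e f by (meson le_trans subsetI)
  ultimately show ?thesis using ef by blast
qed

lemma openin_interval_topology:
  assumes R: "circular_order_on X R"
  shows "openin (interval_topology X R) U \<longleftrightarrow> (\<exists>\<B> \<subseteq> interval_base X R. U = \<Union>\<B>)"
proof
  assume "openin (interval_topology X R) U"
  then have "generate_topology_on (interval_base X R) U"
    by (simp add: interval_topology_def openin_topology_generated_by)
  then have "\<forall>x\<in>U. \<exists>V\<in>interval_base X R. x \<in> V \<and> V \<subseteq> U"
  proof induction
    case (Int A B)
    show ?case
    proof
      fix x assume x: "x \<in> A \<inter> B"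
      obtain V where V: "V \<in> interval_base X R" "x \<in> V" "V \<subseteq> A" using Int.IH(1) x by blast
      obtain W where W: "W \<in> interval_base X R" "x \<in> W" "W \<subseteq> B" using Int.IH(2) x by blast
      have VX: "V \<subseteq> X" "W \<subseteq> X" using V W unfolding interval_base_def by auto
      show "\<exists>V\<in>interval_base X R. x \<in> V \<and> V \<subseteq> A \<inter> B"
      proof (cases "V = X \<or> W = X")
        case True
        then show ?thesis
        proof
          assume "V = X"
          then show ?thesis using V W VX by (intro bexI[of _ W]) auto
        next
          assume "W = X"
          then show ?thesis using V W VX by (intro bexI[of _ V]) auto
        qed
      next
        case False
        then obtain a b c d where abcd: "a \<in> X" "b \<in> X" "c \<in> X" "d \<in> X"
            and VW: "V = X - circ_closed_interval R a b" "W = X - circ_closed_interval R c d"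
          using V W unfolding interval_base_def by auto
        obtain e f where "e \<in> X" "f \<in> X" "x \<notin> circ_closed_interval R e f"
            "circ_closed_interval R a b \<union> circ_closed_interval R c d \<subseteq> circ_closed_interval R e f"
          using circ_closed_intervals_merge[OF R abcd, of x] V(2) W(2) VW by blast
        then show ?thesis
          using V W VW by (intro bexI[of _ "X - circ_closed_interval R e f"]) (auto simp: interval_base_def)
      qed
    qed
  next
    case (UN K)
    show ?case
    proof
      fix x assume "x \<in> \<Union>K"
      then obtain k where k: "k \<in> K" "x \<in> k" by blast
      with UN.IH obtain V where "V \<in> interval_base X R" "x \<in> V" "V \<subseteq> k" by meson
      then show "\<exists>V\<in>interval_base X R. x \<in> V \<and> V \<subseteq> \<Union>K" using k by (intro bexI[of _ V]) auto
    qed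
  qed auto
  then have "U = \<Union>{V \<in> interval_base X R. V \<subseteq> U}" by blast
  then show "\<exists>\<B> \<subseteq> interval_base X R. U = \<Union>\<B>"
    by (intro exI[of _ "{V \<in> interval_base X R. V \<subseteq> U}"]) auto
next
  assume "\<exists>\<B> \<subseteq> interval_base X R. U = \<Union>\<B>"
  then obtain \<B> where \<B>: "\<B> \<subseteq> interval_base X R" "U = \<Union>\<B>" by auto
  have "openin (interval_topology X R) V" if "V \<in> \<B>" for V
    using that \<B>(1) unfolding interval_topology_def by (intro topology_generated_by_Basis) auto
  then show "openin (interval_topology X R) U"
    unfolding \<B>(2) by (rule openin_Union)
qed


section \<open>COP maps and proper compactifications\<close>

definition cop_map ::
  "'a set \<Rightarrow> ('a \<times> 'a \<times> 'a) set \<Rightarrow> 'b set \<Rightarrow> ('b \<times> 'b \<times> 'b) set \<Rightarrow> ('a \<Rightarrow> 'b) \<Rightarrow> bool" where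
  "cop_map X1 R1 X2 R2 f \<longleftrightarrow>
     f \<in> X1 \<rightarrow> X2 \<and>
     (\<forall>a b c. (a, b, c) \<in> R1 \<and> f a \<noteq> f b \<and> f b \<noteq> f c \<and> f a \<noteq> f c \<longrightarrow> (f a, f b, f c) \<in> R2) \<and>
     (\<forall>x\<in>X1. \<forall>y\<in>X1. f x = f y \<longrightarrow>
        f constant_on circ_closed_interval R1 x y \<or> f constant_on circ_closed_interval R1 y x)"

definition proper_co_compactification ::
  "'a set \<Rightarrow> ('a \<times> 'a \<times> 'a) set \<Rightarrow> 'b set \<Rightarrow> ('b \<times> 'b \<times> 'b) set \<Rightarrow> ('a \<Rightarrow> 'b) \<Rightarrow> bool" where
  "proper_co_compactification X R Y S i \<longleftrightarrow>
     circular_order_on Y S \<and>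
     compact_space (interval_topology Y S) \<and>
     i \<in> X \<rightarrow> Y \<and>
     interval_topology Y S closure_of (i ` X) = Y \<and>
     embedding_map (interval_topology X R) (interval_topology Y S) i \<and>
     (\<forall>a\<in>X. \<forall>b\<in>X. \<forall>c\<in>X. (a, b, c) \<in> R \<longleftrightarrow> (i a, i b, i c) \<in> S)"


section \<open>Novak's regular completion\<close>

text \<open>Linear orders are reflexive relations (\<^const>\<open>linear_order_on\<close>), so \<open>a < b\<close>
  reads \<open>(a, b) \<in> L \<and> a \<noteq> b\<close>.\<close>

definition circ_cut :: "'a set \<Rightarrow> ('a \<times> 'a \<times> 'a) set \<Rightarrow> ('a \<times> 'a) set \<Rightarrow> bool" where
  "circ_cut X R L \<longleftrightarrow>
     linear_order_on X L \<and>
     (\<forall>a b c. (a, b) \<in> L \<and> a \<noteq> b \<and> (b, c) \<in> L \<and> b \<noteq> c \<longrightarrow> (a, b, c) \<in> R)"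

definition circ_gap :: "'a set \<Rightarrow> ('a \<times> 'a \<times> 'a) set \<Rightarrow> ('a \<times> 'a) set \<Rightarrow> bool" where
  "circ_gap X R L \<longleftrightarrow>
     circ_cut X R L \<and>
     \<not> (\<exists>m\<in>X. \<forall>x\<in>X. (m, x) \<in> L) \<and>
     \<not> (\<exists>m\<in>X. \<forall>x\<in>X. (x, m) \<in> L)"

definition lower_point_cut :: "'a set \<Rightarrow> ('a \<times> 'a \<times> 'a) set \<Rightarrow> 'a \<Rightarrow> ('a \<times> 'a) set" where
  "lower_point_cut X R x = {(a, b). a \<in> X \<and> b \<in> X \<and> (a = x \<or> a = b \<or> (x, a, b) \<in> R)}"

text \<open>On the empty set the empty order is vacuously a gap, so the completion of the empty circular
  order is a single point; statements about the completion need a nonempty carrier.\<close>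

definition regular_cuts :: "'a set \<Rightarrow> ('a \<times> 'a \<times> 'a) set \<Rightarrow> ('a \<times> 'a) set set" where
  "regular_cuts X R = {L. circ_gap X R L} \<union> lower_point_cut X R ` X"

text \<open>For reflexive linear orders the field is the carrier, so this is the ordinal sum when the
  two fields are disjoint.\<close>

definition ord_sum :: "('a \<times> 'a) set \<Rightarrow> ('a \<times> 'a) set \<Rightarrow> ('a \<times> 'a) set" (infixr \<open>\<oplus>\<^sub>o\<close> 65) where
  "r \<oplus>\<^sub>o s = r \<union> s \<union> Field r \<times> Field s"

definition novak_order ::
  "'a set \<Rightarrow> ('a \<times> 'a \<times> 'a) set \<Rightarrow> (('a \<times> 'a) set \<times> ('a \<times> 'a) set \<times> ('a \<times> 'a) set) set" where
  "novak_order X R = {(L1, L2, L3).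
     L1 \<in> regular_cuts X R \<and> L2 \<in> regular_cuts X R \<and> L3 \<in> regular_cuts X R \<and>
     L1 \<noteq> L2 \<and> L2 \<noteq> L3 \<and> L1 \<noteq> L3 \<and>
     (\<exists>A B D rA rB rD.
        A \<noteq> {} \<and> B \<noteq> {} \<and> D \<noteq> {} \<and>
        A \<inter> B = {} \<and> B \<inter> D = {} \<and> A \<inter> D = {} \<and> A \<union> B \<union> D = X \<and>
        linear_order_on A rA \<and> linear_order_on B rB \<and> linear_order_on D rD \<and>
        L1 = rA \<oplus>\<^sub>o rB \<oplus>\<^sub>o rD \<and> L2 = rB \<oplus>\<^sub>o rD \<oplus>\<^sub>o rA \<and> L3 = rD \<oplus>\<^sub>o rA \<oplus>\<^sub>o rB)}"

lemma circ_cut_lower_point_cut: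
  assumes R: "circular_order_on X R" and x: "x \<in> X"
  shows "circ_cut X R (lower_point_cut X R x)"
proof -
  have cyc: "(v, w, u) \<in> R" if "(u, v, w) \<in> R" for u v w
    using R[unfolded circular_order_on_def, THEN conjunct2, THEN conjunct1] that by blast
  have asym: "(w, v, u) \<notin> R" if "(u, v, w) \<in> R" for u v w
    using R[unfolded circular_order_on_def, THEN conjunct2, THEN conjunct2, THEN conjunct1] that by blast
  have trans: "(u, v, z) \<in> R" if "(u, v, w) \<in> R" "(u, w, z) \<in> R" for u v w z
    using R[unfolded circular_order_on_def, THEN conjunct2, THEN conjunct2, THEN conjunct2, THEN conjunct1] that by blast
  have total: "(u, v, w) \<in> R \<or> (u, w, v) \<in> R"
    if "u \<in> X" "v \<in> X" "w \<in> X" "u \<noteq> v" "v \<noteq> w" "u \<noteq> w" for u v w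
    using R[unfolded circular_order_on_def, THEN conjunct2, THEN conjunct2, THEN conjunct2, THEN conjunct2] that by blast
  have irr: "(u, v, u) \<notin> R" "(u, u, v) \<notin> R" "(v, u, u) \<notin> R" for u v
    using asym cyc by metis+
  let ?L = "lower_point_cut X R x"
  have mem: "(a, b) \<in> ?L \<longleftrightarrow> a \<in> X \<and> b \<in> X \<and> (a = x \<or> a = b \<or> (x, a, b) \<in> R)" for a b
    unfolding lower_point_cut_def by simp
  have "linear_order_on X ?L"
    unfolding linear_order_on_def partial_order_on_def preorder_on_def
  proof (intro conjI)
    show "?L \<subseteq> X \<times> X" "refl_on X ?L"
      unfolding refl_on_def lower_point_cut_def by auto
    show "trans ?L"
    proof (rule transI)
      fix a b c assume "(a, b) \<in> ?L" "(b, c) \<in> ?L"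
      then show "(a, c) \<in> ?L" using trans irr unfolding mem by metis
    qed
    show "antisym ?L"
    proof (rule antisymI)
      fix a b assume "(a, b) \<in> ?L" "(b, a) \<in> ?L"
      then show "a = b" using trans irr unfolding mem by metis
    qed
    show "total_on X ?L"
      unfolding total_on_def mem using total x by metis
  qed
  moreover have "(a, b, c) \<in> R" if ab: "(a, b) \<in> ?L" "a \<noteq> b" and bc: "(b, c) \<in> ?L" "b \<noteq> c" for a b c
  proof -
    have "b \<noteq> x" using ab irr unfolding mem by blast
    then have xbc: "(x, b, c) \<in> R" using bc unfolding mem by blast
    show ?thesis
    proof (cases "a = x")
      case False
      then have "(x, a, b) \<in> R" using ab unfolding mem by blast
      then have "(b, c, a) \<in> R" using trans[OF cyc[OF xbc]] cyc by metis
      then show ?thesis using cyc by metis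
    qed (use xbc in simp)
  qed
  ultimately show ?thesis unfolding circ_cut_def by blast
qed

end

theory Submission
  imports Defs
begin

text \<open>
  Every \<open>y\<close> in \<open>Y\<close> induces a cut of \<open>X\<close>: read \<open>X\<close> inside \<open>Y\<close> in the linear order that starts at \<open>y\<close>.
  If \<open>y\<close> is the image of \<open>x\<close>, this is the lower point-cut of \<open>x\<close>; otherwise it is a gap, because
  \<open>X\<close> is dense and carries its own interval topology as a subspace of \<open>Y\<close>. Compactness of \<open>Y\<close>
  places a point in every gap, so this map is onto the regular cuts, and it turns the order of \<open>Y\<close>
  into \<open>novak_order\<close>, which is thereby seen to be a circular order. Its fibres are finite, since
  two points with the same cut are adjacent; this gives continuity. Uniqueness holds because
  interval topologies are Hausdorff and the image of \<open>X\<close> is dense.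
\<close>

section \<open>Elementary facts on circular orders and rankings of finitely many points\<close>

lemma circular_order_onD:
  assumes "circular_order_on X R"
  shows circ_in_carrier: "(a, b, c) \<in> R \<Longrightarrow> a \<in> X \<and> b \<in> X \<and> c \<in> X"
    and circ_cyclic: "(a, b, c) \<in> R \<Longrightarrow> (b, c, a) \<in> R"
    and circ_asym: "(a, b, c) \<in> R \<Longrightarrow> (c, b, a) \<notin> R"
    and circ_trans: "(a, b, c) \<in> R \<Longrightarrow> (a, c, d) \<in> R \<Longrightarrow> (a, b, d) \<in> R"
    and circ_total: "a \<in> X \<Longrightarrow> b \<in> X \<Longrightarrow> c \<in> X \<Longrightarrow> a \<noteq> b \<Longrightarrow> b \<noteq> c \<Longrightarrow> a \<noteq> c \<Longrightarrow>
      (a, b, c) \<in> R \<or> (a, c, b) \<in> R"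
proof -
  note a0 = assms[unfolded circular_order_on_def, THEN conjunct1]
  note a1 = assms[unfolded circular_order_on_def, THEN conjunct2, THEN conjunct1]
  note a2 = assms[unfolded circular_order_on_def, THEN conjunct2, THEN conjunct2, THEN conjunct1]
  note a3 = assms[unfolded circular_order_on_def, THEN conjunct2, THEN conjunct2, THEN conjunct2, THEN conjunct1]
  note a4 = assms[unfolded circular_order_on_def, THEN conjunct2, THEN conjunct2, THEN conjunct2, THEN conjunct2]
  show "(a, b, c) \<in> R \<Longrightarrow> a \<in> X \<and> b \<in> X \<and> c \<in> X" using a0 by blast
  show "(a, b, c) \<in> R \<Longrightarrow> (b, c, a) \<in> R" using a1 by blast
  show "(a, b, c) \<in> R \<Longrightarrow> (c, b, a) \<notin> R" using a2 by blast
  show "(a, b, c) \<in> R \<Longrightarrow> (a, c, d) \<in> R \<Longrightarrow> (a, b, d) \<in> R" using a3 by blast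
  show "a \<in> X \<Longrightarrow> b \<in> X \<Longrightarrow> c \<in> X \<Longrightarrow> a \<noteq> b \<Longrightarrow> b \<noteq> c \<Longrightarrow> a \<noteq> c \<Longrightarrow>
      (a, b, c) \<in> R \<or> (a, c, b) \<in> R" using a4 by blast
qed

lemma circ_distinct:
  assumes R: "circular_order_on X R" and abc: "(a, b, c) \<in> R"
  shows "a \<noteq> b \<and> b \<noteq> c \<and> a \<noteq> c"
  using circ_asym[OF R] circ_cyclic[OF R] abc by metis

text \<open>A ranking cuts the circle open and numbers the points from the cut; the three disjuncts
  are the rotations of an increasing triple. Equality is part of it so that every atom about points
  of \<open>F\<close> can be rewritten into one about natural numbers.\<close>

definition circ_ranking :: "'a set \<Rightarrow> ('a \<times> 'a \<times> 'a) set \<Rightarrow> ('a \<Rightarrow> nat) \<Rightarrow> bool" where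
  "circ_ranking F R f \<longleftrightarrow>
     (\<forall>u\<in>F. \<forall>v\<in>F. u = v \<longleftrightarrow> f u = f v) \<and>
     (\<forall>u\<in>F. \<forall>v\<in>F. \<forall>w\<in>F. (u, v, w) \<in> R \<longleftrightarrow>
        f u < f v \<and> f v < f w \<or> f v < f w \<and> f w < f u \<or> f w < f u \<and> f u < f v)"

lemma circ_rankingD:
  assumes "circ_ranking F R f"
  shows "u \<in> F \<Longrightarrow> v \<in> F \<Longrightarrow> u = v \<longleftrightarrow> f u = f v"
    and "u \<in> F \<Longrightarrow> v \<in> F \<Longrightarrow> w \<in> F \<Longrightarrow> (u, v, w) \<in> R \<longleftrightarrow>
      f u < f v \<and> f v < f w \<or> f v < f w \<and> f w < f u \<or> f w < f u \<and> f u < f v"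
  by (rule assms[unfolded circ_ranking_def, THEN conjunct1, rule_format],
      assumption+,
      rule assms[unfolded circ_ranking_def, THEN conjunct2, rule_format])

text \<open>Statements about finitely many points of a circular order thereby become linear arithmetic.\<close>

lemma ex_circ_ranking:
  assumes R: "circular_order_on X R" and F: "finite F" "F \<subseteq> X" "p \<in> F"
  shows "\<exists>f. circ_ranking F R f \<and> f p = 0"
proof -
  have p: "p \<in> X" using F by blast
  define L where "L = lower_point_cut X R p"
  have L: "circ_cut X R L" unfolding L_def by (rule circ_cut_lower_point_cut[OF R p])
  then have lin: "linear_order_on X L" unfolding circ_cut_def by blast
  have tr: "(u, w) \<in> L" if "(u, v) \<in> L" "(v, w) \<in> L" for u v w
    using lin that unfolding linear_order_on_def partial_order_on_def preorder_on_def trans_def by blast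
  have an: "u = v" if "(u, v) \<in> L" "(v, u) \<in> L" for u v
    using lin that unfolding linear_order_on_def partial_order_on_def antisym_def by blast
  have tot: "(u, v) \<in> L \<or> (v, u) \<in> L" if "u \<in> F" "v \<in> F" "u \<noteq> v" for u v
    using lin that F unfolding linear_order_on_def total_on_def by blast
  \<comment> \<open>The rank is the number of strict predecessors in the cut that starts at
    \<open>p\<close>; hence \<open>p\<close> itself gets rank 0, which later simplifies away many
    order cases.\<close>
  define f where "f v = card {w \<in> F. (w, v) \<in> L \<and> w \<noteq> v}" for v
  have mono: "f u < f v" if "u \<in> F" "v \<in> F" "(u, v) \<in> L" "u \<noteq> v" for u v
    unfolding f_def
  proof (rule psubset_card_mono)
    show "{w \<in> F. (w, u) \<in> L \<and> w \<noteq> u} \<subset> {w \<in> F. (w, v) \<in> L \<and> w \<noteq> v}"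
      using that tr an by blast
  qed (use F in simp)
  have eq: "u = v \<longleftrightarrow> f u = f v" if "u \<in> F" "v \<in> F" for u v
    using tot[OF that] mono that by (metis less_irrefl)
  have less: "f u < f v \<longleftrightarrow> (u, v) \<in> L \<and> u \<noteq> v" if "u \<in> F" "v \<in> F" for u v
    using tot[OF that] mono that by (metis less_asym less_irrefl)
  have cut: "(u, v, w) \<in> R" if "u \<in> F" "v \<in> F" "w \<in> F" "f u < f v" "f v < f w" for u v w
    using L that unfolding circ_cut_def by (simp add: less)
  have "(u, v, w) \<in> R \<longleftrightarrow>
      f u < f v \<and> f v < f w \<or> f v < f w \<and> f w < f u \<or> f w < f u \<and> f u < f v"
    if uvw: "u \<in> F" "v \<in> F" "w \<in> F" for u v w
    proof
      assume r: "(u, v, w) \<in> R"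
      \<comment> \<open>These are the three odd rearrangements of the triple. With them excluded,
        only the rotations survive among the six strict orders of the ranks.\<close>
      have "(w, v, u) \<notin> R" "(v, u, w) \<notin> R" "(u, w, v) \<notin> R"
        using r circ_asym[OF R] circ_cyclic[OF R] by metis+
      moreover have "f u \<noteq> f v" "f v \<noteq> f w" "f u \<noteq> f w"
        using circ_distinct[OF R r] eq uvw by simp_all
      ultimately show "f u < f v \<and> f v < f w \<or> f v < f w \<and> f w < f u \<or> f w < f u \<and> f u < f v"
        using cut uvw by (metis linorder_neqE_nat)
    next
      assume "f u < f v \<and> f v < f w \<or> f v < f w \<and> f w < f u \<or> f w < f u \<and> f u < f v"
      then show "(u, v, w) \<in> R" using cut uvw circ_cyclic[OF R] by metis
    qed
  then have "circ_ranking F R f"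
    unfolding circ_ranking_def by (intro conjI ballI eq) assumption+
  moreover have "(p, w) \<in> L" if "w \<in> F" for w
    using that p F by (auto simp: L_def lower_point_cut_def)
  then have "{w \<in> F. (w, p) \<in> L \<and> w \<noteq> p} = {}" using an by blast
  then have "f p = 0" unfolding f_def by (simp only: card.empty)
  ultimately show ?thesis by blast
qed

text \<open>The ranked set is kept abstract so that its membership conditions can be used as rewrite
  rules together with the translation of equality in \<open>circ_rankingD\<close>.\<close>

lemma circ_ranking_points:
  assumes "circular_order_on X R" and "set (p # ps) \<subseteq> X"
  obtains F f where "circ_ranking F R f" and "list_all (\<lambda>q. q \<in> F) (p # ps)" and "f p = 0"
  using ex_circ_ranking[OF assms(1) _ assms(2), of p] by (auto simp: list_all_iff)

section \<open>Open and closed sets of the interval topology, and the Hausdorff property\<close>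

lemma circ_closed_interval_self:
  assumes "circular_order_on X R"
  shows "circ_closed_interval R a a = {a}"
  using circ_asym[OF assms]
  by (auto simp: circ_closed_interval_def circ_open_interval_def)

text \<open>The degenerate interval \<open>[a, a]\<close> is \<open>{a}\<close>, so the complement
  of a point is itself a member of the base.\<close>

lemma openin_diff_singleton:
  assumes "circular_order_on X R" "a \<in> X"
  shows "openin (interval_topology X R) (X - {a})"
  unfolding interval_topology_def
  by (rule topology_generated_by_Basis)
    (use assms circ_closed_interval_self[OF assms(1), of a] in \<open>auto simp: interval_base_def\<close>)

lemma closedin_interval_topology_finite:
  assumes R: "circular_order_on X R" and F: "finite F" "F \<subseteq> X"
  shows "closedin (interval_topology X R) F"
  using F
proof (induction rule: finite_induct)
  case (insert a F)
  have "closedin (interval_topology X R) {a}"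
    using openin_diff_singleton[OF R, of a] insert by (simp add: closedin_def)
  then show ?case using insert closedin_Un[of _ "{a}" F] by simp
qed simp

text \<open>Points off both ends lie on exactly one of the two arcs. For \<open>a = b\<close> the
  left side would be \<open>X - {a}\<close> and the right side empty, which is why the ends must
  differ.\<close>

lemma compl_circ_closed_interval:
  assumes R: "circular_order_on X R" and ab: "a \<in> X" "b \<in> X" "a \<noteq> b"
  shows "X - circ_closed_interval R b a = circ_open_interval R a b"
proof -
  have "x \<in> X \<and> x \<notin> circ_closed_interval R b a \<longleftrightarrow> x \<in> circ_open_interval R a b" for x
  proof (cases "x \<in> X")
    case True
    obtain F f where f: "circ_ranking F R f" "list_all (\<lambda>p. p \<in> F) [a, b, x]" "f a = 0"
      by (rule circ_ranking_points[OF R, of a "[b, x]"]) (use ab True in auto)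
    note F = f(2)[simplified] f(3)
    show ?thesis using True ab
      by (simp add: circ_closed_interval_def circ_open_interval_def circ_rankingD[OF f(1)] F) linarith
  next
    case False
    then show ?thesis using circ_in_carrier[OF R] by (auto simp: circ_open_interval_def)
  qed
  then show ?thesis by blast
qed

lemma openin_circ_open_interval:
  assumes R: "circular_order_on X R" and ab: "a \<in> X" "b \<in> X" "a \<noteq> b"
  shows "openin (interval_topology X R) (circ_open_interval R a b)"
  unfolding compl_circ_closed_interval[OF assms, symmetric] interval_topology_def
  by (rule topology_generated_by_Basis) (use ab in \<open>auto simp: interval_base_def\<close>)

lemma closedin_circ_closed_interval:
  assumes R: "circular_order_on X R" and ab: "a \<in> X" "b \<in> X"
  shows "closedin (interval_topology X R) (circ_closed_interval R a b)"
proof -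
  have "circ_closed_interval R a b \<subseteq> X"
    using circ_in_carrier[OF R] ab
    by (auto simp: circ_closed_interval_def circ_open_interval_def)
  moreover have "openin (interval_topology X R) (X - circ_closed_interval R a b)"
    unfolding interval_topology_def
    by (rule topology_generated_by_Basis) (use ab in \<open>auto simp: interval_base_def\<close>)
  ultimately show ?thesis by (simp add: closedin_def)
qed

text \<open>The cases ask which of the two open arcs between \<open>p\<close> and \<open>q\<close>
  contain points. A point on an arc serves as a common end of two disjoint neighbourhoods; along an
  empty arc \<open>p\<close> and \<open>q\<close> are adjacent, and each can be the end of the
  neighbourhood of the other. If both arcs are empty, the space has only two points.\<close>

lemma Hausdorff_interval_topology:
  assumes R: "circular_order_on X R"
  shows "Hausdorff_space (interval_topology X R)"
  unfolding Hausdorff_space_def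
proof (intro allI impI)
  fix p q assume "p \<in> topspace (interval_topology X R) \<and> q \<in> topspace (interval_topology X R) \<and> p \<noteq> q"
  then have pq: "p \<in> X" "q \<in> X" "p \<noteq> q" by auto
  let ?thesis = "\<exists>U V. openin (interval_topology X R) U \<and> openin (interval_topology X R) V \<and>
      p \<in> U \<and> q \<in> V \<and> disjnt U V"
  have sep: ?thesis
    if X: "u \<in> X" "v \<in> X" "s \<in> X" "w \<in> X" "u \<noteq> v" "s \<noteq> w"
      and mem: "(u, p, v) \<in> R" "(s, q, w) \<in> R"
      and disj: "\<And>z. z \<in> X \<Longrightarrow> (u, z, v) \<in> R \<Longrightarrow> (s, z, w) \<notin> R" for u v s w
  proof (intro exI conjI)
    show "openin (interval_topology X R) (circ_open_interval R u v)"
      "openin (interval_topology X R) (circ_open_interval R s w)"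
      using openin_circ_open_interval[OF R] X by blast+
    show "p \<in> circ_open_interval R u v" "q \<in> circ_open_interval R s w"
      using mem by (simp_all add: circ_open_interval_def)
    show "disjnt (circ_open_interval R u v) (circ_open_interval R s w)"
      using disj circ_in_carrier[OF R] by (auto simp: disjnt_def circ_open_interval_def)
  qed
  consider (none) "\<nexists>r. (p, r, q) \<in> R" "\<nexists>t. (q, t, p) \<in> R"
    | (both) r t where "(p, r, q) \<in> R" "(q, t, p) \<in> R"
    | (one) r where "(p, r, q) \<in> R" "\<nexists>t. (q, t, p) \<in> R"
    | (other) t where "(q, t, p) \<in> R" "\<nexists>r. (p, r, q) \<in> R" by blast
  then show ?thesis
  proof cases
    case none
    then have "X \<subseteq> {p, q}" using circ_total[OF R, of p _ q] circ_cyclic[OF R] pq by blast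
    then have "disjnt (X - {q}) (X - {p})" by (auto simp: disjnt_def)
    then show ?thesis using openin_diff_singleton[OF R] pq
      by (intro exI[of _ "X - {q}"] exI[of _ "X - {p}"]) auto
  next
    case both
    then have rt: "r \<in> X" "t \<in> X" using circ_in_carrier[OF R] by blast+
    have "(t, p, r) \<in> R \<and> (r, q, t) \<in> R \<and> t \<noteq> r \<and> ((t, z, r) \<in> R \<longrightarrow> (r, z, t) \<notin> R)"
      if z: "z \<in> X" for z
    proof -
      obtain F f where f: "circ_ranking F R f" "list_all (\<lambda>p. p \<in> F) [p, q, r, t, z]" "f p = 0"
        by (rule circ_ranking_points[OF R, of p "[q, r, t, z]"]) (use pq rt z in auto)
      note F = f(2)[simplified] f(3)
      show ?thesis using both pq(3) by (simp add: circ_rankingD[OF f(1)] F)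
    qed
    then show ?thesis using sep[of t r r t] rt by blast
  next
    case one
    then have r: "r \<in> X" using circ_in_carrier[OF R] by blast
    have "(q, p, r) \<in> R \<and> (r, q, p) \<in> R \<and> q \<noteq> r \<and> r \<noteq> p \<and> ((q, z, r) \<in> R \<longrightarrow> (r, z, p) \<notin> R)"
      if z: "z \<in> X" for z
    proof -
      obtain F f where f: "circ_ranking F R f" "list_all (\<lambda>p. p \<in> F) [p, q, r, z]" "f p = 0"
        by (rule circ_ranking_points[OF R, of p "[q, r, z]"]) (use pq r z in auto)
      note F = f(2)[simplified] f(3)
      have "(q, z, p) \<notin> R" using one by blast
      then show ?thesis using one(1) pq(3) by (simp add: circ_rankingD[OF f(1)] F)
    qed
    then show ?thesis using sep[of q r r p] r pq by blast
  next
    case other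
    then have t: "t \<in> X" using circ_in_carrier[OF R] by blast
    have "(t, p, q) \<in> R \<and> (p, q, t) \<in> R \<and> t \<noteq> q \<and> p \<noteq> t \<and> ((t, z, q) \<in> R \<longrightarrow> (p, z, t) \<notin> R)"
      if z: "z \<in> X" for z
    proof -
      obtain F f where f: "circ_ranking F R f" "list_all (\<lambda>p. p \<in> F) [p, q, t, z]" "f p = 0"
        by (rule circ_ranking_points[OF R, of p "[q, t, z]"]) (use pq t z in auto)
      note F = f(2)[simplified] f(3)
      have "(p, z, q) \<notin> R" using other by blast
      then show ?thesis using other(1) pq(3) by (simp add: circ_rankingD[OF f(1)] F) linarith
    qed
    then show ?thesis using sep[of t q p t] t pq by blast
  qed
qed

section \<open>Linear orders and ordinal sums\<close>

lemma linear_order_onD: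
  assumes "linear_order_on A r"
  shows linear_order_on_subset: "r \<subseteq> A \<times> A"
    and linear_order_on_refl: "a \<in> A \<Longrightarrow> (a, a) \<in> r"
    and linear_order_on_trans: "(a, b) \<in> r \<Longrightarrow> (b, c) \<in> r \<Longrightarrow> (a, c) \<in> r"
    and linear_order_on_antisym: "(a, b) \<in> r \<Longrightarrow> (b, a) \<in> r \<Longrightarrow> a = b"
    and linear_order_on_total: "a \<in> A \<Longrightarrow> b \<in> A \<Longrightarrow> (a, b) \<in> r \<or> (b, a) \<in> r"
proof -
  have r: "r \<subseteq> A \<times> A" "refl_on A r" "trans r" "antisym r" "total_on A r"
    using assms unfolding linear_order_on_def partial_order_on_def preorder_on_def by auto
  show "r \<subseteq> A \<times> A" by (rule r)
  show "a \<in> A \<Longrightarrow> (a, a) \<in> r" using r(2) by (rule refl_onD)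
  show "(a, b) \<in> r \<Longrightarrow> (b, c) \<in> r \<Longrightarrow> (a, c) \<in> r" using r(3) by (rule transD)
  show "(a, b) \<in> r \<Longrightarrow> (b, a) \<in> r \<Longrightarrow> a = b" using r(4) by (rule antisymD)
  show "(a, b) \<in> r \<or> (b, a) \<in> r" if "a \<in> A" "b \<in> A"
    using r(2,5) that by (cases "a = b") (auto simp: total_on_def refl_on_def)
qed

lemma linear_order_onI:
  assumes "r \<subseteq> A \<times> A" and "\<And>a. a \<in> A \<Longrightarrow> (a, a) \<in> r"
    and "\<And>a b c. (a, b) \<in> r \<Longrightarrow> (b, c) \<in> r \<Longrightarrow> (a, c) \<in> r"
    and "\<And>a b. (a, b) \<in> r \<Longrightarrow> (b, a) \<in> r \<Longrightarrow> a = b"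
    and "\<And>a b. a \<in> A \<Longrightarrow> b \<in> A \<Longrightarrow> (a, b) \<in> r \<or> (b, a) \<in> r"
  shows "linear_order_on A r"
  unfolding linear_order_on_def partial_order_on_def preorder_on_def
proof (intro conjI)
  show "refl_on A r" using assms(2) by (rule refl_onI)
  show "trans r" using assms(3) by (rule transI)
  show "antisym r" using assms(4) by (rule antisymI)
  show "total_on A r" using assms(5) by (simp add: total_on_def)
qed (rule assms(1))

text \<open>A pair of \<open>s\<close> missing from \<open>r\<close> would occur reversed in
  \<open>r\<close> by totality, hence in \<open>s\<close>, against antisymmetry. Thus one inclusion
  is enough to identify two cuts.\<close>

lemma linear_order_on_subset_eq:
  assumes "linear_order_on A r" "linear_order_on A s" "r \<subseteq> s"
  shows "r = s"
proof
  show "s \<subseteq> r"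
  proof (rule subrelI)
    fix a b assume ab: "(a, b) \<in> s"
    then have "a \<in> A" "b \<in> A" using linear_order_on_subset[OF assms(2)] by blast+
    then show "(a, b) \<in> r"
      using linear_order_on_total[OF assms(1), of a b] linear_order_on_antisym[OF assms(2) ab]
        linear_order_on_refl[OF assms(1)] assms(3) by blast
  qed
qed (rule assms(3))

lemma linear_order_on_restrict:
  assumes "linear_order_on X r" "A \<subseteq> X"
  shows "linear_order_on A (r \<inter> A \<times> A)"
proof (rule linear_order_onI)
  show "(a, c) \<in> r \<inter> A \<times> A" if "(a, b) \<in> r \<inter> A \<times> A" "(b, c) \<in> r \<inter> A \<times> A" for a b c
    using that linear_order_on_trans[OF assms(1)] by blast
  show "a = b" if "(a, b) \<in> r \<inter> A \<times> A" "(b, a) \<in> r \<inter> A \<times> A" for a b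
    using that linear_order_on_antisym[OF assms(1)] by blast
qed (use assms linear_order_on_refl[OF assms(1)] linear_order_on_total[OF assms(1)] in blast)+

lemma Field_restrict_linear_order:
  assumes "linear_order_on X r" "A \<subseteq> X"
  shows "Field (r \<inter> A \<times> A) = A"
  using linear_order_on_refl[OF assms(1)] assms(2) by (auto simp: Field_def)

lemma Field_ord_sum: "Field (r \<oplus>\<^sub>o s) = Field r \<union> Field s"
  by (auto simp: ord_sum_def Field_def)

text \<open>Split \<open>r\<close> into nine blocks: the three forward ones are full by
  \<open>less\<close>, the three backward ones are empty by antisymmetry, and the diagonal ones are
  the restrictions. This produces the decompositions required by \<open>novak_order\<close>.\<close>

lemma linear_order_eq_ord_sum:
  assumes r: "linear_order_on X r" and X: "A \<union> B \<union> D = X"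
    and disj: "A \<inter> B = {}" "B \<inter> D = {}" "A \<inter> D = {}"
    and less: "A \<times> B \<subseteq> r" "B \<times> D \<subseteq> r" "A \<times> D \<subseteq> r"
  shows "r = (r \<inter> A \<times> A) \<oplus>\<^sub>o (r \<inter> B \<times> B) \<oplus>\<^sub>o (r \<inter> D \<times> D)"
proof -
  have sub: "A \<subseteq> X" "B \<subseteq> X" "D \<subseteq> X" using X by auto
  have not: "(b, a) \<notin> r" if "(a, b) \<in> r" "a \<noteq> b" for a b
    using linear_order_on_antisym[OF r] that by blast
  have BA: "r \<inter> B \<times> A = {}" using less(1) disj(1) not by blast
  have DB: "r \<inter> D \<times> B = {}" using less(2) disj(2) not by blast
  have DA: "r \<inter> D \<times> A = {}" using less(3) disj(3) not by blast
  have "r \<subseteq> r \<inter> A \<times> A \<union> (r \<inter> B \<times> B \<union> r \<inter> D \<times> D \<union> B \<times> D) \<union> A \<times> (B \<union> D)"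
  proof (rule subrelI)
    fix a b assume ab: "(a, b) \<in> r"
    then have "a \<in> A \<or> a \<in> B \<or> a \<in> D" "b \<in> A \<or> b \<in> B \<or> b \<in> D"
      using linear_order_on_subset[OF r] X by blast+
    moreover have "\<not> (a \<in> B \<and> b \<in> A)" "\<not> (a \<in> D \<and> b \<in> B)" "\<not> (a \<in> D \<and> b \<in> A)"
      using ab BA DB DA by blast+
    ultimately show "(a, b) \<in> r \<inter> A \<times> A \<union> (r \<inter> B \<times> B \<union> r \<inter> D \<times> D \<union> B \<times> D) \<union> A \<times> (B \<union> D)"
      using ab by auto
  qed
  then have "r = r \<inter> A \<times> A \<union> (r \<inter> B \<times> B \<union> r \<inter> D \<times> D \<union> B \<times> D) \<union> A \<times> (B \<union> D)"
    using less by auto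
  then show ?thesis
    \<comment> \<open>The outer sum is unfolded first, so that the field of the inner sum is still
      visible to \<open>Field_ord_sum\<close>.\<close>
    by (simp add: ord_sum_def[of "r \<inter> A \<times> A"] Field_ord_sum Field_restrict_linear_order[OF r] sub)
      (simp add: ord_sum_def Field_restrict_linear_order[OF r] sub)
qed

section \<open>Reversal of a circular order\<close>

text \<open>Reversal keeps the interval topology and the notion of proper compactification but
  exchanges successors and predecessors, so one-sided density needs only one proof.\<close>

definition circ_reverse :: "('a \<times> 'a \<times> 'a) set \<Rightarrow> ('a \<times> 'a \<times> 'a) set" where
  "circ_reverse R = {(a, b, c). (c, b, a) \<in> R}"

lemma circ_reverse_iff [simp]: "(a, b, c) \<in> circ_reverse R \<longleftrightarrow> (c, b, a) \<in> R"
  by (simp add: circ_reverse_def)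

lemma circular_order_on_reverse:
  assumes R: "circular_order_on X R"
  shows "circular_order_on X (circ_reverse R)"
  unfolding circular_order_on_def circ_reverse_iff
proof (intro conjI allI ballI impI)
  show "circ_reverse R \<subseteq> X \<times> X \<times> X"
    using circ_in_carrier[OF R] by (auto simp: circ_reverse_def)
  show "(a, c, b) \<in> R" if "(c, b, a) \<in> R" for a b c
    using circ_cyclic[OF R] that by blast
  show "(a, b, c) \<notin> R" if "(c, b, a) \<in> R" for a b c
    using circ_asym[OF R] that by blast
  show "(d, b, a) \<in> R" if "(c, b, a) \<in> R \<and> (d, c, a) \<in> R" for a b c d
  proof -
    have "(a, d, c) \<in> R" "(a, c, b) \<in> R" using that circ_cyclic[OF R] by blast+
    then have "(a, d, b) \<in> R" by (rule circ_trans[OF R])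
    then show ?thesis using circ_cyclic[OF R] by blast
  qed
  show "(c, b, a) \<in> R \<or> (b, c, a) \<in> R"
    if "a \<in> X" "b \<in> X" "c \<in> X" "a \<noteq> b \<and> b \<noteq> c \<and> a \<noteq> c" for a b c
    using circ_total[OF R, of a b c] circ_cyclic[OF R] that by blast
qed

text \<open>Each closed interval only has its ends exchanged, and the base ranges over all pairs of
  ends.\<close>

lemma interval_topology_reverse:
  "interval_topology X (circ_reverse R) = interval_topology X R"
proof -
  have "circ_closed_interval (circ_reverse R) a b = circ_closed_interval R b a" for a b
    by (auto simp: circ_closed_interval_def circ_open_interval_def)
  then have "interval_base X (circ_reverse R) = interval_base X R"
    by (auto simp: interval_base_def)
  then show ?thesis by (simp add: interval_topology_def)
qed

lemma proper_co_compactification_reverse: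
  assumes "proper_co_compactification X R Y S i"
  shows "proper_co_compactification X (circ_reverse R) Y (circ_reverse S) i"
  using assms by (simp add: proper_co_compactification_def interval_topology_reverse
      circular_order_on_reverse)

section \<open>Density of the image in a proper compactification\<close>

locale proper_compactification =
  fixes X :: "'a set" and R :: "('a \<times> 'a \<times> 'a) set"
    and Y :: "'b set" and S :: "('b \<times> 'b \<times> 'b) set" and i :: "'a \<Rightarrow> 'b"
  assumes circ_X: "circular_order_on X R"
    and comp: "proper_co_compactification X R Y S i"
begin

lemma circ_Y: "circular_order_on Y S"
  and compact_Y: "compact_space (interval_topology Y S)"
  and image_in: "x \<in> X \<Longrightarrow> i x \<in> Y"
  and closure_image: "interval_topology Y S closure_of (i ` X) = Y"
  and embedding: "embedding_map (interval_topology X R) (interval_topology Y S) i"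
  and order_iff: "a \<in> X \<Longrightarrow> b \<in> X \<Longrightarrow> c \<in> X \<Longrightarrow> (a, b, c) \<in> R \<longleftrightarrow> (i a, i b, i c) \<in> S"
  using comp unfolding proper_co_compactification_def by auto

lemma continuous_embedding: "continuous_map (interval_topology X R) (interval_topology Y S) i"
  using embedding unfolding embedding_map_def
  by (meson continuous_map_in_subtopology homeomorphic_imp_continuous_map)

lemma inj_embedding: "a \<in> X \<Longrightarrow> b \<in> X \<Longrightarrow> i a = i b \<longleftrightarrow> a = b"
  using embedding homeomorphic_imp_injective_map[of "interval_topology X R" _ i]
  unfolding embedding_map_def inj_on_def by auto

lemma dense:
  assumes "openin (interval_topology Y S) U" "y \<in> U"
  shows "\<exists>x\<in>X. i x \<in> U"
proof -
  have "i ` X \<inter> U \<noteq> {}"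
    using closure_image assms dense_intersects_open[of "interval_topology Y S" "i ` X"] by auto
  then show ?thesis by blast
qed

lemma dense_interval:
  assumes "(a, y, b) \<in> S"
  shows "\<exists>x\<in>X. (a, i x, b) \<in> S"
proof -
  have "a \<in> Y" "b \<in> Y" "a \<noteq> b"
    using circ_in_carrier[OF circ_Y assms] circ_distinct[OF circ_Y assms] by auto
  then show ?thesis
    using dense[OF openin_circ_open_interval[OF circ_Y], of a b y] assms
    by (simp add: circ_open_interval_def)
qed

text \<open>This is where the two topologies on \<open>X\<close> have to agree: if \<open>i m\<close> were the successor
  of \<open>y\<close> in \<open>Y\<close>, then \<open>[m, c)\<close> would be open in \<open>X\<close>, so \<open>m\<close> would have a predecessor \<open>b\<close> in \<open>X\<close>,
  and \<open>y\<close> would lie in the interval from \<open>i b\<close> to \<open>i m\<close>, which has no points of \<open>X\<close>.\<close>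

lemma between_new_and_old_point:
  assumes y: "y \<in> Y" "y \<notin> i ` X" and m: "m \<in> X"
  shows "\<exists>x\<in>X. (y, i x, i m) \<in> S"
proof (rule ccontr)
  assume "\<not> ?thesis"
  then have H: "(y, i x, i m) \<notin> S" if "x \<in> X" for x using that by blast
  have new: "y \<noteq> i x" if "x \<in> X" for x using y that by blast
  \<comment> \<open>Seen from \<open>y\<close>, the point \<open>m\<close> now comes before all
    other points of \<open>X\<close>.\<close>
  have first: "(y, i m, i x) \<in> S" if "x \<in> X" "x \<noteq> m" for x
    using circ_total[OF circ_Y y(1) image_in[OF m] image_in[OF that(1)]] H[OF that(1)]
      new[OF that(1)] new[OF m] inj_embedding[OF m that(1)] that(2) by auto
  \<comment> \<open>A second point of \<open>X\<close> exists by density, because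
    \<open>Y - {i m}\<close> is an open set containing \<open>y\<close>.\<close>
  obtain c where c: "c \<in> X" "c \<noteq> m"
    using dense[OF openin_diff_singleton[OF circ_Y image_in[OF m]], of y] new[OF m] y(1) by auto
  \<comment> \<open>In the order of \<open>X\<close> this is \<open>[m, c)\<close>; continuity of
    \<open>i\<close> makes it open.\<close>
  define V where "V = {x \<in> X. (y, i x, i c) \<in> S}"
  have "openin (interval_topology X R) V"
    using openin_continuous_map_preimage[OF continuous_embedding
        openin_circ_open_interval[OF circ_Y y(1) image_in[OF c(1)] new[OF c(1)]]]
    by (simp add: V_def circ_open_interval_def)
  moreover have mV: "m \<in> V" using first c m by (simp add: V_def)
  moreover have cV: "c \<notin> V" using circ_distinct[OF circ_Y] by (auto simp: V_def)
  \<comment> \<open>Here openness is read in the interval topology of \<open>X\<close> itself. As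
    \<open>W\<close> avoids \<open>c\<close>, it is the complement of an interval
    \<open>[a, b]\<close>.\<close>
  ultimately obtain W where W: "W \<in> interval_base X R" "m \<in> W" "W \<subseteq> V"
    unfolding openin_interval_topology[OF circ_X] by blast
  then have "W \<noteq> X" using cV c by blast
  then obtain a b where ab: "a \<in> X" "b \<in> X" "W = X - circ_closed_interval R a b"
    using W(1) unfolding interval_base_def by blast
  have mab: "m \<noteq> a" "m \<noteq> b" "(i a, i m, i b) \<notin> S"
    using W(2) ab order_iff[OF ab(1) m ab(2)]
    by (auto simp: circ_closed_interval_def circ_open_interval_def)
  have cab: "c = a \<or> c = b \<or> (i a, i c, i b) \<in> S"
    using W(3) cV c ab order_iff[OF ab(1) c(1) ab(2)]
    by (auto simp: circ_closed_interval_def circ_open_interval_def)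
  \<comment> \<open>Counted from \<open>m\<close>, the point \<open>c\<close> is not after
    \<open>b\<close>. A point \<open>x\<close> of \<open>X\<close> with \<open>i x\<close> between
    \<open>i b\<close> and \<open>i m\<close> would have to come before \<open>y\<close>, as nothing
    of \<open>X\<close> lies between \<open>y\<close> and \<open>i m\<close>; it would then be
    outside both \<open>[a, b]\<close> and \<open>V\<close>, contrary to
    \<open>W \<subseteq> V\<close>.\<close>
  have "(i b, y, i m) \<in> S" using first[OF ab(2)] mab circ_cyclic[OF circ_Y] by blast
  then obtain x where x: "x \<in> X" "(i b, i x, i m) \<in> S" using dense_interval by blast
  have xab: "x = a \<or> x = b \<or> (i a, i x, i b) \<in> S \<or> (y, i x, i c) \<in> S"
    using W(3) x(1) ab order_iff[OF ab(1) x(1) ab(2)]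
    by (auto simp: V_def circ_closed_interval_def circ_open_interval_def)
  obtain F f where f: "circ_ranking F S f" "list_all (\<lambda>p. p \<in> F) [y, i a, i b, i c, i m, i x]"
      "f y = 0"
    by (rule circ_ranking_points[OF circ_Y, of y "[i a, i b, i c, i m, i x]"])
      (use y ab c m x image_in in auto)
  note F = f(2)[simplified] f(3)
  have "y \<noteq> i m" "y \<noteq> i x" "y \<noteq> i a" "y \<noteq> i b" "i m \<noteq> i a" "i m \<noteq> i b"
    using new m x ab inj_embedding mab by auto
  moreover have "i c = i a \<or> i c = i b \<or> (i a, i c, i b) \<in> S"
    "i x = i a \<or> i x = i b \<or> (i a, i x, i b) \<in> S \<or> (y, i x, i c) \<in> S"
    using cab xab by auto
  moreover note H[OF ab(1)] H[OF ab(2)] H[OF c(1)] H[OF x(1)] mab(3) x(2)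
  ultimately show False
    by (simp add: circ_rankingD[OF f(1)] F)
qed

end

text \<open>The mirror image of \<open>between_new_and_old_point\<close>, read off in the reversed
  orders.\<close>

lemma (in proper_compactification) between_old_and_new_point:
  assumes "y \<in> Y" "y \<notin> i ` X" "m \<in> X"
  shows "\<exists>x\<in>X. (i m, i x, y) \<in> S"
proof -
  interpret rev: proper_compactification X "circ_reverse R" Y "circ_reverse S" i
    by unfold_locales
      (use circ_X comp circular_order_on_reverse proper_co_compactification_reverse in auto)
  show ?thesis using rev.between_new_and_old_point[OF assms] by simp
qed

section \<open>The cut of \<open>X\<close> induced by a point of \<open>Y\<close>\<close>

context proper_compactification
begin

text \<open>This is the lower point-cut of \<open>y\<close> in \<open>Y\<close>, pulled back along
  \<open>i\<close>. The disjunct \<open>i a = y\<close> can hold only when \<open>y\<close> is in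
  the image.\<close>

definition trace_cut :: "'b \<Rightarrow> ('a \<times> 'a) set" where
  "trace_cut y = {(a, b). a \<in> X \<and> b \<in> X \<and> (a = b \<or> i a = y \<or> (y, i a, i b) \<in> S)}"

text \<open>Equality is moved into \<open>Y\<close>, so that a ranking of points of \<open>Y\<close>
  can translate every order atom.\<close>

lemma trace_cut_iff:
  "(a, b) \<in> trace_cut y \<longleftrightarrow> a \<in> X \<and> b \<in> X \<and> (i a = i b \<or> i a = y \<or> (y, i a, i b) \<in> S)"
  using inj_embedding by (auto simp: trace_cut_def)

lemma trace_cut_image: "x \<in> X \<Longrightarrow> trace_cut (i x) = lower_point_cut X R x"
  using order_iff inj_embedding by (auto simp: trace_cut_def lower_point_cut_def)

lemma circ_cut_trace_cut:
  assumes y: "y \<in> Y"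
  shows "circ_cut X R (trace_cut y)"
proof -
  define L where "L = lower_point_cut Y S y"
  have L: "circ_cut Y S L" unfolding L_def by (rule circ_cut_lower_point_cut[OF circ_Y y])
  then have lin: "linear_order_on Y L" unfolding circ_cut_def by blast
  have iff: "(a, b) \<in> trace_cut y \<longleftrightarrow> a \<in> X \<and> b \<in> X \<and> (i a, i b) \<in> L" for a b
    using image_in by (auto simp: trace_cut_iff L_def lower_point_cut_def)
  have "linear_order_on X (trace_cut y)"
  proof (rule linear_order_onI)
    show "trace_cut y \<subseteq> X \<times> X" by (auto simp: trace_cut_def)
    show "(a, a) \<in> trace_cut y" if "a \<in> X" for a using that by (simp add: trace_cut_def)
    show "(a, c) \<in> trace_cut y" if "(a, b) \<in> trace_cut y" "(b, c) \<in> trace_cut y" for a b c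
      using that linear_order_on_trans[OF lin] unfolding iff by blast
    show "a = b" if "(a, b) \<in> trace_cut y" "(b, a) \<in> trace_cut y" for a b
      using that linear_order_on_antisym[OF lin] inj_embedding unfolding iff by blast
    show "(a, b) \<in> trace_cut y \<or> (b, a) \<in> trace_cut y" if "a \<in> X" "b \<in> X" for a b
      using that linear_order_on_total[OF lin] image_in unfolding iff by blast
  qed
  moreover have "(a, b, c) \<in> R"
    if "(a, b) \<in> trace_cut y \<and> a \<noteq> b \<and> (b, c) \<in> trace_cut y \<and> b \<noteq> c" for a b c
    using L that order_iff inj_embedding unfolding circ_cut_def iff by metis
  ultimately show ?thesis unfolding circ_cut_def by blast
qed

lemma linear_order_on_trace_cut: "y \<in> Y \<Longrightarrow> linear_order_on X (trace_cut y)"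
  using circ_cut_trace_cut unfolding circ_cut_def by blast

text \<open>A least element \<open>m\<close> is refuted by a point of \<open>X\<close> between
  \<open>y\<close> and \<open>i m\<close>, a greatest one by a point between \<open>i m\<close> and
  \<open>y\<close>.\<close>

lemma circ_gap_trace_cut:
  assumes y: "y \<in> Y" "y \<notin> i ` X"
  shows "circ_gap X R (trace_cut y)"
  unfolding circ_gap_def
proof (intro conjI notI)
  show "circ_cut X R (trace_cut y)" by (rule circ_cut_trace_cut[OF y(1)])
next
  assume "\<exists>m\<in>X. \<forall>x\<in>X. (m, x) \<in> trace_cut y"
  then obtain m where m: "m \<in> X" "\<And>x. x \<in> X \<Longrightarrow> (m, x) \<in> trace_cut y" by blast
  obtain x where x: "x \<in> X" "(y, i x, i m) \<in> S"
    using between_new_and_old_point[OF y m(1)] by blast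
  then have "i m = i x \<or> (y, i m, i x) \<in> S"
    using m(2)[OF x(1)] y m(1) by (auto simp: trace_cut_iff)
  then show False
    using x circ_asym[OF circ_Y] circ_cyclic[OF circ_Y] circ_distinct[OF circ_Y x(2)] by metis
next
  assume "\<exists>m\<in>X. \<forall>x\<in>X. (x, m) \<in> trace_cut y"
  then obtain m where m: "m \<in> X" "\<And>x. x \<in> X \<Longrightarrow> (x, m) \<in> trace_cut y" by blast
  obtain x where x: "x \<in> X" "(i m, i x, y) \<in> S"
    using between_old_and_new_point[OF y m(1)] by blast
  then have "i m = i x \<or> (y, i x, i m) \<in> S"
    using m(2)[OF x(1)] y m(1) by (auto simp: trace_cut_iff)
  then show False
    using x circ_asym[OF circ_Y] circ_distinct[OF circ_Y x(2)] by metis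
qed

lemma trace_cut_regular: "y \<in> Y \<Longrightarrow> trace_cut y \<in> regular_cuts X R"
  using circ_gap_trace_cut trace_cut_image by (auto simp: regular_cuts_def)

section \<open>Compactness puts a point into every gap\<close>

text \<open>For \<open>a\<close> before \<open>b\<close> in \<open>L\<close>, the arc from
  \<open>i b\<close> round to \<open>i a\<close> passes over the place where \<open>L\<close> is cut
  open. Moving \<open>a\<close> down and \<open>b\<close> up shrinks it, which makes the family of
  these arcs directed.\<close>

lemma circ_closed_interval_image_mono:
  assumes cut: "circ_cut X R L"
    and L: "(a', a) \<in> L" "(a, b) \<in> L" "a \<noteq> b" "(b, b') \<in> L"
  shows "circ_closed_interval S (i b') (i a') \<subseteq> circ_closed_interval S (i b) (i a)"
proof
  fix y assume y: "y \<in> circ_closed_interval S (i b') (i a')"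
  have lin: "linear_order_on X L" using cut unfolding circ_cut_def by blast
  have X: "a' \<in> X" "a \<in> X" "b \<in> X" "b' \<in> X" using linear_order_on_subset[OF lin] L by auto
  have cutD: "(i u, i v, i w) \<in> S" if "(u, v) \<in> L" "u \<noteq> v" "(v, w) \<in> L" "v \<noteq> w" for u v w
    using cut that order_iff linear_order_on_subset[OF lin] unfolding circ_cut_def by blast
  have ab': "(a, b') \<in> L" "a \<noteq> b'"
    using linear_order_on_trans[OF lin] linear_order_on_antisym[OF lin] L by blast+
  have 1: "i a' = i a \<or> (i a', i a, i b) \<in> S" using cutD L by auto
  have 2: "i a' = i a \<or> (i a', i a, i b') \<in> S" using cutD L ab' by auto
  have 3: "i b = i b' \<or> (i a, i b, i b') \<in> S" using cutD L by auto
  have yY: "y \<in> Y"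
    using y image_in X circ_in_carrier[OF circ_Y]
    by (auto simp: circ_closed_interval_def circ_open_interval_def)
  obtain F f where f: "circ_ranking F S f" "list_all (\<lambda>p. p \<in> F) [i a, i a', i b, i b', y]"
      "f (i a) = 0"
    by (rule circ_ranking_points[OF circ_Y, of "i a" "[i a', i b, i b', y]"])
      (use yY X image_in in auto)
  note F = f(2)[simplified] f(3)
  have "i a \<noteq> i b" "i a \<noteq> i b'" using inj_embedding X L ab' by auto
  then show "y \<in> circ_closed_interval S (i b) (i a)"
    using 1 2 3 y unfolding circ_closed_interval_def circ_open_interval_def
    by (simp add: circ_rankingD[OF f(1)] F; linarith)
qed

text \<open>The arcs passing over the gap are closed and directed downwards, so by compactness they
  share a point \<open>y\<close>. Since \<open>L\<close> has no ends, \<open>y\<close> is not in the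
  image of \<open>X\<close>; hence it lies strictly inside every such arc, and reading
  \<open>X\<close> from \<open>y\<close> gives back \<open>L\<close>.\<close>

lemma circ_gap_is_trace_cut:
  assumes gap: "circ_gap X R L" and nonempty: "X \<noteq> {}"
  shows "\<exists>y\<in>Y. trace_cut y = L"
proof -
  have cut: "circ_cut X R L" using gap unfolding circ_gap_def by blast
  then have lin: "linear_order_on X L" unfolding circ_cut_def by blast
  have below: "\<exists>a\<in>X. (a, x) \<in> L \<and> a \<noteq> x" if "x \<in> X" for x
    using gap that linear_order_on_total[OF lin] linear_order_on_refl[OF lin]
    unfolding circ_gap_def by metis
  have above: "\<exists>a\<in>X. (x, a) \<in> L \<and> a \<noteq> x" if "x \<in> X" for x
    using gap that linear_order_on_total[OF lin] linear_order_on_refl[OF lin]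
    unfolding circ_gap_def by metis
  define \<C> where "\<C> = {circ_closed_interval S (i b) (i a) |a b. (a, b) \<in> L \<and> a \<noteq> b}"
  have fip: "\<exists>a b. (a, b) \<in> L \<and> a \<noteq> b \<and> circ_closed_interval S (i b) (i a) \<subseteq> \<Inter>\<F>"
    if "finite \<F>" "\<F> \<subseteq> \<C>" for \<F>
    using that
  proof (induction rule: finite_induct)
    case empty
    \<comment> \<open>The claim asks for an actual pair even when the intersection is over no sets;
      a point of \<open>X\<close> and one below it provide it.\<close>
    then show ?case using nonempty below by auto
  next
    case (insert C \<F>)
    have "C \<in> \<C>" "\<F> \<subseteq> \<C>" using insert.prems by simp_all
    obtain a b where ab: "(a, b) \<in> L" "a \<noteq> b"
      and sub: "circ_closed_interval S (i b) (i a) \<subseteq> \<Inter>\<F>"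
      using insert.IH[OF \<open>\<F> \<subseteq> \<C>\<close>] by (elim exE conjE)
    from \<open>C \<in> \<C>\<close> obtain c d where cd: "(c, d) \<in> L" "c \<noteq> d"
      and C: "C = circ_closed_interval S (i d) (i c)" unfolding \<C>_def by blast
    have X: "a \<in> X" "b \<in> X" "c \<in> X" "d \<in> X" using ab cd linear_order_on_subset[OF lin] by auto
    \<comment> \<open>\<open>e\<close> is the lower of \<open>a\<close> and \<open>c\<close>, and
      \<open>g\<close> below is the upper of \<open>b\<close> and \<open>d\<close>; the arc from
      \<open>i g\<close> to \<open>i e\<close> is inside both given arcs.\<close>
    obtain e where e: "(e, a) \<in> L" "(e, c) \<in> L"
      using linear_order_on_total[OF lin X(1,3)] linear_order_on_refl[OF lin] X by blast
    obtain g where g: "(b, g) \<in> L" "(d, g) \<in> L"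
      using linear_order_on_total[OF lin X(2,4)] linear_order_on_refl[OF lin] X by blast
    have "(e, g) \<in> L" "e \<noteq> g"
      using linear_order_on_trans[OF lin] linear_order_on_antisym[OF lin] ab e g by blast+
    then show ?case
      using circ_closed_interval_image_mono[OF cut e(1) ab g(1)]
        circ_closed_interval_image_mono[OF cut e(2) cd g(2)] sub C by blast
  qed
  have "\<forall>C\<in>\<C>. closedin (interval_topology Y S) C"
    using closedin_circ_closed_interval[OF circ_Y] image_in linear_order_on_subset[OF lin]
    unfolding \<C>_def by blast
  moreover have "\<Inter>\<F> \<noteq> {}" if "finite \<F>" "\<F> \<subseteq> \<C>" for \<F>
    using fip[OF that] unfolding circ_closed_interval_def by blast
  ultimately have "\<Inter>\<C> \<noteq> {}"
    using compact_Y[unfolded compact_space_fip, rule_format, of \<C>] by blast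
  then obtain y where y: "y \<in> \<Inter>\<C>" by blast
  have mem: "y \<in> circ_closed_interval S (i b) (i a)" if "(a, b) \<in> L" "a \<noteq> b" for a b
    using y that unfolding \<C>_def by blast
  have new: "y \<noteq> i x" if x: "x \<in> X" for x
  proof
    assume yx: "y = i x"
    \<comment> \<open>Were \<open>y\<close> the image of \<open>x\<close>, neighbours
      \<open>a\<close> and \<open>b\<close> on both sides of \<open>x\<close> in \<open>L\<close>
      would give an arc of the family that misses \<open>i x\<close>.\<close>
    obtain a b where ab: "a \<in> X" "b \<in> X" "(a, x) \<in> L" "a \<noteq> x" "(x, b) \<in> L" "b \<noteq> x"
      using below[OF x] above[OF x] by blast
    have "(a, x, b) \<in> R" using cut ab unfolding circ_cut_def by blast
    then have axb: "(i a, i x, i b) \<in> S" using order_iff ab x by blast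
    have "(a, b) \<in> L" using linear_order_on_trans[OF lin] ab by blast
    moreover have "a \<noteq> b" using linear_order_on_antisym[OF lin] ab by blast
    ultimately have "i x \<in> circ_closed_interval S (i b) (i a)" using mem yx by blast
    then show False
      using axb circ_asym[OF circ_Y axb] circ_distinct[OF circ_Y axb]
      by (auto simp: circ_closed_interval_def circ_open_interval_def)
  qed
  have between: "(i b, y, i a) \<in> S" if "(a, b) \<in> L" "a \<noteq> b" for a b
    using mem[OF that] new[of a] new[of b] linear_order_on_subset[OF lin] that
    by (auto simp: circ_closed_interval_def circ_open_interval_def)
  have yY: "y \<in> Y"
    using nonempty below between circ_in_carrier[OF circ_Y] by (meson ex_in_conv)
  have "L \<subseteq> trace_cut y"
  proof (rule subrelI)
    fix a b assume ab: "(a, b) \<in> L"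
    then have "a \<in> X" "b \<in> X" using linear_order_on_subset[OF lin] by auto
    then show "(a, b) \<in> trace_cut y"
      using between[OF ab] circ_cyclic[OF circ_Y] unfolding trace_cut_def by blast
  qed
  then show ?thesis
    using linear_order_on_subset_eq[OF lin linear_order_on_trace_cut[OF yY]] yY by auto
qed

text \<open>For empty \<open>X\<close> density forces \<open>Y = {}\<close>, while the empty order
  still counts as a gap; hence the assumption.\<close>

lemma trace_cut_surj:
  assumes "X \<noteq> {}"
  shows "trace_cut ` Y = regular_cuts X R"
proof
  show "trace_cut ` Y \<subseteq> regular_cuts X R" using trace_cut_regular by blast
  show "regular_cuts X R \<subseteq> trace_cut ` Y"
  proof
    fix L assume "L \<in> regular_cuts X R"
    then consider "circ_gap X R L" | x where "x \<in> X" "L = lower_point_cut X R x"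
      unfolding regular_cuts_def by blast
    then show "L \<in> trace_cut ` Y"
    proof cases
      case 1
      then show ?thesis using circ_gap_is_trace_cut assms by blast
    next
      case 2
      then show ?thesis using trace_cut_image image_in by (metis imageI)
    qed
  qed
qed

section \<open>Half-open arcs of \<open>Y\<close> traced on \<open>X\<close>, and equality of
  cuts\<close>

text \<open>Closed on the left to match lower point-cuts, where the base point comes first;
  consecutive arcs then tile \<open>X\<close> without overlap.\<close>

definition trace_ico :: "'b \<Rightarrow> 'b \<Rightarrow> 'a set" where
  "trace_ico p q = {x \<in> X. i x = p \<or> (p, i x, q) \<in> S}"

text \<open>Moving the base point from \<open>p\<close> to \<open>q\<close> carries the block
  \<open>trace_ico p q\<close> from the front of the order to its end. An empty block changes
  nothing.\<close>

lemma trace_cut_eq_if: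
  assumes pq: "p \<in> Y" "q \<in> Y" and empty: "trace_ico p q = {}"
  shows "trace_cut p = trace_cut q"
proof -
  have "(a, b) \<in> trace_cut p \<longleftrightarrow> (a, b) \<in> trace_cut q" if ab: "a \<in> X" "b \<in> X" for a b
  proof -
    have e: "i a \<noteq> p" "(p, i a, q) \<notin> S" "i b \<noteq> p" "(p, i b, q) \<notin> S"
      using empty ab by (auto simp: trace_ico_def)
    obtain F f where f: "circ_ranking F S f" "list_all (\<lambda>p. p \<in> F) [p, q, i a, i b]" "f p = 0"
      by (rule circ_ranking_points[OF circ_Y, of p "[q, i a, i b]"]) (use pq ab image_in in auto)
    note F = f(2)[simplified] f(3)
    show ?thesis using e ab unfolding trace_cut_iff
      by (simp add: circ_rankingD[OF f(1)] F; linarith)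
  qed
  then show ?thesis by (auto simp: trace_cut_def)
qed

text \<open>If both blocks had a member, \<open>a\<close> from \<open>p\<close> to \<open>q\<close>
  and \<open>b\<close> from \<open>q\<close> to \<open>p\<close>, then the cut at \<open>p\<close>
  would put \<open>a\<close> first and the cut at \<open>q\<close> would put \<open>b\<close>
  first.\<close>

lemma trace_cut_eqD:
  assumes pq: "p \<in> Y" "q \<in> Y" "p \<noteq> q" and eq: "trace_cut p = trace_cut q"
  shows "trace_ico p q = {} \<or> trace_ico q p = {}"
proof (rule ccontr)
  assume "\<not> ?thesis"
  then obtain a b where ab: "a \<in> X" "b \<in> X"
    and a: "i a = p \<or> (p, i a, q) \<in> S" and b: "i b = q \<or> (q, i b, p) \<in> S"
    by (auto simp: trace_ico_def)
  obtain F f where f: "circ_ranking F S f" "list_all (\<lambda>p. p \<in> F) [p, q, i a, i b]" "f p = 0"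
    by (rule circ_ranking_points[OF circ_Y, of p "[q, i a, i b]"]) (use pq ab image_in in auto)
  note F = f(2)[simplified] f(3)
  have "(a, b) \<in> trace_cut p" using ab a b pq(3) unfolding trace_cut_iff
    by (simp add: circ_rankingD[OF f(1)] F; linarith)
  moreover have "(a, b) \<notin> trace_cut q" using ab a b pq(3) unfolding trace_cut_iff
    by (simp add: circ_rankingD[OF f(1)] F; linarith)
  ultimately show False using eq by simp
qed

lemma trace_cut_constant:
  assumes pq: "p \<in> Y" "q \<in> Y" and empty: "trace_ico p q = {}" and z: "z \<in> circ_closed_interval S p q"
  shows "trace_cut z = trace_cut p"
proof -
  consider "z = p" | "z = q" | "(p, z, q) \<in> S"
    using z by (auto simp: circ_closed_interval_def circ_open_interval_def)
  then show ?thesis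
  proof cases
    case 3
    have "trace_ico p z \<subseteq> trace_ico p q"
      using circ_trans[OF circ_Y _ 3] 3 by (auto simp: trace_ico_def)
    then show ?thesis
      using trace_cut_eq_if[OF pq(1), of z] empty circ_in_carrier[OF circ_Y 3] by auto
  qed (use trace_cut_eq_if[OF pq empty] in auto)
qed

text \<open>For a circularly ordered triple in \<open>Y\<close>, the half-open intervals between its members
  trace out the pieces \<open>A, B, D\<close> of the definition of \<open>novak_order\<close>.\<close>

lemma trace_ico_partition:
  assumes S: "(p, q, r) \<in> S"
  shows "trace_ico p q \<union> trace_ico q r \<union> trace_ico r p = X"
    and "trace_ico p q \<inter> trace_ico q r = {}"
proof -
  have Y: "p \<in> Y" "q \<in> Y" "r \<in> Y" using circ_in_carrier[OF circ_Y S] by auto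
  have "(a \<in> trace_ico p q \<or> a \<in> trace_ico q r \<or> a \<in> trace_ico r p) \<and>
    \<not> (a \<in> trace_ico p q \<and> a \<in> trace_ico q r)" if a: "a \<in> X" for a
  proof -
    obtain F f where f: "circ_ranking F S f" "list_all (\<lambda>p. p \<in> F) [p, q, r, i a]" "f p = 0"
      by (rule circ_ranking_points[OF circ_Y, of p "[q, r, i a]"]) (use Y a image_in in auto)
    note F = f(2)[simplified] f(3)
    show ?thesis using S a unfolding trace_ico_def mem_Collect_eq
      by (simp add: circ_rankingD[OF f(1)] F; linarith)
  qed
  then show "trace_ico p q \<union> trace_ico q r \<union> trace_ico r p = X"
    "trace_ico p q \<inter> trace_ico q r = {}"
    by (auto simp: trace_ico_def)
qed

text \<open>Only the comparisons that start from one block are stated; the rotations of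
  \<open>(p, q, r)\<close> supply those for the other two.\<close>

lemma trace_ico_less:
  assumes S: "(p, q, r) \<in> S"
  shows "trace_ico p q \<times> trace_ico q r \<subseteq> trace_cut p"
    and "trace_ico p q \<times> trace_ico q r \<subseteq> trace_cut r"
    and "trace_ico p q \<times> trace_ico r p \<subseteq> trace_cut p"
    and "trace_cut q \<inter> trace_ico p q \<times> trace_ico p q = trace_cut p \<inter> trace_ico p q \<times> trace_ico p q"
    and "trace_cut r \<inter> trace_ico p q \<times> trace_ico p q = trace_cut p \<inter> trace_ico p q \<times> trace_ico p q"
proof -
  have Y: "p \<in> Y" "q \<in> Y" "r \<in> Y" using circ_in_carrier[OF circ_Y S] by auto
  have "(a \<in> trace_ico p q \<longrightarrow> b \<in> trace_ico q r \<longrightarrow> (a, b) \<in> trace_cut p \<and> (a, b) \<in> trace_cut r) \<and>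
    (a \<in> trace_ico p q \<longrightarrow> b \<in> trace_ico r p \<longrightarrow> (a, b) \<in> trace_cut p) \<and>
    (a \<in> trace_ico p q \<longrightarrow> b \<in> trace_ico p q \<longrightarrow>
      ((a, b) \<in> trace_cut q \<longleftrightarrow> (a, b) \<in> trace_cut p) \<and>
      ((a, b) \<in> trace_cut r \<longleftrightarrow> (a, b) \<in> trace_cut p))" if ab: "a \<in> X" "b \<in> X" for a b
  proof -
    obtain F f where f: "circ_ranking F S f" "list_all (\<lambda>p. p \<in> F) [p, q, r, i a, i b]" "f p = 0"
      by (rule circ_ranking_points[OF circ_Y, of p "[q, r, i a, i b]"]) (use Y ab image_in in auto)
    note F = f(2)[simplified] f(3)
    show ?thesis using S ab unfolding trace_ico_def mem_Collect_eq trace_cut_iff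
      by (simp add: circ_rankingD[OF f(1)] F)
  qed
  note H = this
  have sub: "a \<in> X" if "a \<in> trace_ico u v" for a u v using that by (simp add: trace_ico_def)
  have 1: "(a, b) \<in> trace_cut p \<and> (a, b) \<in> trace_cut r"
    if "a \<in> trace_ico p q" "b \<in> trace_ico q r" for a b
    using H[OF sub[OF that(1)] sub[OF that(2)]] that by blast
  have 2: "(a, b) \<in> trace_cut p" if "a \<in> trace_ico p q" "b \<in> trace_ico r p" for a b
    using H[OF sub[OF that(1)] sub[OF that(2)]] that by blast
  have 3: "((a, b) \<in> trace_cut q \<longleftrightarrow> (a, b) \<in> trace_cut p) \<and>
      ((a, b) \<in> trace_cut r \<longleftrightarrow> (a, b) \<in> trace_cut p)"
    if "a \<in> trace_ico p q" "b \<in> trace_ico p q" for a b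
    using H[OF sub[OF that(1)] sub[OF that(2)]] that by blast
  show "trace_ico p q \<times> trace_ico q r \<subseteq> trace_cut p"
    "trace_ico p q \<times> trace_ico q r \<subseteq> trace_cut r" using 1 by auto
  show "trace_ico p q \<times> trace_ico r p \<subseteq> trace_cut p" using 2 by auto
  show "trace_cut q \<inter> trace_ico p q \<times> trace_ico p q = trace_cut p \<inter> trace_ico p q \<times> trace_ico p q"
    "trace_cut r \<inter> trace_ico p q \<times> trace_ico p q = trace_cut p \<inter> trace_ico p q \<times> trace_ico p q"
    using 3 by auto
qed

section \<open>Comparison of the order of \<open>Y\<close> with \<open>novak_order\<close>\<close>

text \<open>Passing from \<open>p\<close> to \<open>q\<close> to \<open>r\<close> rotates the blocks
  \<open>A\<close>, \<open>B\<close>, \<open>D\<close> and keeps the order inside each. The blocks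
  are nonempty because an empty one would make two of the cuts equal.\<close>

lemma novak_order_trace_cutI:
  assumes S: "(p, q, r) \<in> S"
    and ne: "trace_cut p \<noteq> trace_cut q" "trace_cut q \<noteq> trace_cut r" "trace_cut p \<noteq> trace_cut r"
  shows "(trace_cut p, trace_cut q, trace_cut r) \<in> novak_order X R"
proof -
  have Y: "p \<in> Y" "q \<in> Y" "r \<in> Y" using circ_in_carrier[OF circ_Y S] by auto
  have S': "(q, r, p) \<in> S" "(r, p, q) \<in> S" using S circ_cyclic[OF circ_Y] by blast+
  let ?A = "trace_ico p q" and ?B = "trace_ico q r" and ?D = "trace_ico r p"
  let ?rA = "trace_cut p \<inter> ?A \<times> ?A" and ?rB = "trace_cut p \<inter> ?B \<times> ?B"
    and ?rD = "trace_cut p \<inter> ?D \<times> ?D"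
  have U: "?A \<union> ?B \<union> ?D = X" by (rule trace_ico_partition[OF S])
  have disj: "?A \<inter> ?B = {}" "?B \<inter> ?D = {}" "?D \<inter> ?A = {}"
    using trace_ico_partition(2)[OF S] trace_ico_partition(2)[OF S'(1)]
      trace_ico_partition(2)[OF S'(2)] by auto
  have sub: "?A \<subseteq> X" "?B \<subseteq> X" "?D \<subseteq> X" using U by blast+
  have ne': "?A \<noteq> {}" "?B \<noteq> {}" "?D \<noteq> {}"
    using trace_cut_eq_if[OF Y(1,2)] trace_cut_eq_if[OF Y(2,3)] trace_cut_eq_if[OF Y(3,1)] ne by auto
  note less = trace_ico_less[OF S] trace_ico_less[OF S'(1)] trace_ico_less[OF S'(2)]
  have eq: "trace_cut q \<inter> ?A \<times> ?A = ?rA" "trace_cut q \<inter> ?B \<times> ?B = ?rB" "trace_cut q \<inter> ?D \<times> ?D = ?rD"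
    "trace_cut r \<inter> ?A \<times> ?A = ?rA" "trace_cut r \<inter> ?B \<times> ?B = ?rB" "trace_cut r \<inter> ?D \<times> ?D = ?rD"
    using less by simp_all
  have "trace_cut p = ?rA \<oplus>\<^sub>o ?rB \<oplus>\<^sub>o ?rD"
    by (rule linear_order_eq_ord_sum[OF linear_order_on_trace_cut[OF Y(1)]])
      (use U disj less in auto)
  moreover have "trace_cut q = ?rB \<oplus>\<^sub>o ?rD \<oplus>\<^sub>o ?rA"
    \<comment> \<open>The summands become restrictions of \<open>trace_cut q\<close> itself, the
      form in which \<open>linear_order_eq_ord_sum\<close> states them.\<close>
    unfolding eq(1-3)[symmetric]
    by (rule linear_order_eq_ord_sum[OF linear_order_on_trace_cut[OF Y(2)]])
      (use U disj less in auto)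
  moreover have "trace_cut r = ?rD \<oplus>\<^sub>o ?rA \<oplus>\<^sub>o ?rB"
    unfolding eq(4-6)[symmetric]
    by (rule linear_order_eq_ord_sum[OF linear_order_on_trace_cut[OF Y(3)]])
      (use U disj less in auto)
  moreover have "linear_order_on ?A ?rA" "linear_order_on ?B ?rB" "linear_order_on ?D ?rD"
    using linear_order_on_restrict[OF linear_order_on_trace_cut[OF Y(1)]] sub by blast+
  moreover have "?A \<inter> ?D = {}" using disj(3) by blast
  moreover note trace_cut_regular[OF Y(1)] trace_cut_regular[OF Y(2)] trace_cut_regular[OF Y(3)]
    ne ne' U disj(1,2)
  ultimately show ?thesis
    unfolding novak_order_def mem_Collect_eq case_prod_conv
    by - (intro conjI; (rule exI[of _ ?A], rule exI[of _ ?B], rule exI[of _ ?D], rule exI[of _ ?rA],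
          rule exI[of _ ?rB], rule exI[of _ ?rD], intro conjI)?; assumption)
qed

text \<open>A cut that lists \<open>a\<close>, \<open>b\<close>, \<open>d\<close> in this order must
  have been opened after \<open>d\<close> and not after \<open>a\<close>, which locates
  \<open>y\<close> in a half-open arc.\<close>

lemma trace_cut_chain:
  assumes y: "y \<in> Y" and abd: "(a, b) \<in> trace_cut y" "(b, d) \<in> trace_cut y"
    and ne: "a \<noteq> b" "b \<noteq> d"
  shows "y = i a \<or> (i d, y, i a) \<in> S" and "(i a, i b, i d) \<in> S"
proof -
  have X: "a \<in> X" "b \<in> X" "d \<in> X" using abd by (auto simp: trace_cut_def)
  then have i_ne: "i a \<noteq> i b" "i b \<noteq> i d" using inj_embedding ne by auto
  obtain F f where f: "circ_ranking F S f" "list_all (\<lambda>p. p \<in> F) [y, i a, i b, i d]" "f y = 0"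
    by (rule circ_ranking_points[OF circ_Y, of y "[i a, i b, i d]"]) (use y X image_in in auto)
  note F = f(2)[simplified] f(3)
  show "y = i a \<or> (i d, y, i a) \<in> S" "(i a, i b, i d) \<in> S"
    using abd i_ne unfolding trace_cut_iff
    by (simp add: circ_rankingD[OF f(1)] F X; linarith)+
qed

text \<open>Take one point from each piece. By \<open>trace_cut_chain\<close> the three sums place
  \<open>p\<close>, \<open>q\<close>, \<open>r\<close> in the consecutive arcs
  \<open>(d, a]\<close>, \<open>(a, b]\<close>, \<open>(b, d]\<close>, which fixes their circular
  order.\<close>

lemma novak_order_trace_cutD:
  assumes Y: "p \<in> Y" "q \<in> Y" "r \<in> Y"
    and N: "(trace_cut p, trace_cut q, trace_cut r) \<in> novak_order X R"
  shows "(p, q, r) \<in> S"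
proof -
  obtain A B D rA rB rD where
    ne: "A \<noteq> {}" "B \<noteq> {}" "D \<noteq> {}" and disj: "A \<inter> B = {}" "B \<inter> D = {}" "A \<inter> D = {}"
    and U: "A \<union> B \<union> D = X"
    and lin: "linear_order_on A rA" "linear_order_on B rB" "linear_order_on D rD"
    and eq: "trace_cut p = rA \<oplus>\<^sub>o rB \<oplus>\<^sub>o rD" "trace_cut q = rB \<oplus>\<^sub>o rD \<oplus>\<^sub>o rA"
      "trace_cut r = rD \<oplus>\<^sub>o rA \<oplus>\<^sub>o rB"
    using N unfolding novak_order_def mem_Collect_eq case_prod_conv by (elim conjE exE)
  obtain a b d where abd: "a \<in> A" "b \<in> B" "d \<in> D" using ne by blast
  have "a \<in> Field rA" "b \<in> Field rB" "d \<in> Field rD"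
    using linear_order_on_refl[OF lin(1) abd(1)] linear_order_on_refl[OF lin(2) abd(2)]
      linear_order_on_refl[OF lin(3) abd(3)] by (auto simp: Field_def)
  then have T: "(a, b) \<in> trace_cut p" "(b, d) \<in> trace_cut p" "(b, d) \<in> trace_cut q"
    "(d, a) \<in> trace_cut q" "(d, a) \<in> trace_cut r" "(a, b) \<in> trace_cut r"
    unfolding eq by (simp_all add: ord_sum_def[of rA "rB \<oplus>\<^sub>o rD"] ord_sum_def[of rB "rD \<oplus>\<^sub>o rA"]
        ord_sum_def[of rD "rA \<oplus>\<^sub>o rB"] Field_ord_sum) (simp_all add: ord_sum_def)
  have X: "a \<in> X" "b \<in> X" "d \<in> X" using abd U by auto
  have "a \<noteq> b" "b \<noteq> d" "a \<noteq> d" using abd disj by auto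
  then have pos: "p = i a \<or> (i d, p, i a) \<in> S" "(i a, i b, i d) \<in> S"
    "q = i b \<or> (i a, q, i b) \<in> S" "r = i d \<or> (i b, r, i d) \<in> S"
    using trace_cut_chain[OF Y(1) T(1,2)] trace_cut_chain[OF Y(2) T(3,4)]
      trace_cut_chain[OF Y(3) T(5,6)] by auto
  obtain F f where f: "circ_ranking F S f" "list_all (\<lambda>p. p \<in> F) [i a, p, q, r, i b, i d]"
      "f (i a) = 0"
    by (rule circ_ranking_points[OF circ_Y, of "i a" "[p, q, r, i b, i d]"])
      (use Y X image_in in auto)
  note F = f(2)[simplified] f(3)
  show ?thesis using pos by (simp add: circ_rankingD[OF f(1)] F; linarith)
qed

text \<open>Along the surjection \<open>trace_cut\<close>, \<open>novak_order\<close> corresponds to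
  \<open>S\<close> on triples with distinct cuts, so each axiom is inherited from
  \<open>S\<close>.\<close>

lemma circular_order_on_novak_order:
  assumes "X \<noteq> {}"
  shows "circular_order_on (regular_cuts X R) (novak_order X R)"
proof -
  note N_def = novak_order_def mem_Collect_eq case_prod_conv
  have carrier: "\<exists>p\<in>Y. L = trace_cut p" if "L \<in> regular_cuts X R" for L
    using trace_cut_surj[OF assms] that by blast
  have N: "\<exists>p q r. L1 = trace_cut p \<and> L2 = trace_cut q \<and> L3 = trace_cut r \<and> (p, q, r) \<in> S \<and>
      L1 \<noteq> L2 \<and> L2 \<noteq> L3 \<and> L1 \<noteq> L3" if L: "(L1, L2, L3) \<in> novak_order X R" for L1 L2 L3
  proof -
    have mem: "L1 \<in> regular_cuts X R" "L2 \<in> regular_cuts X R" "L3 \<in> regular_cuts X R"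
      "L1 \<noteq> L2" "L2 \<noteq> L3" "L1 \<noteq> L3" using L unfolding N_def by blast+
    then show ?thesis using carrier novak_order_trace_cutD L by metis
  qed
  show ?thesis
    unfolding circular_order_on_def
  proof (intro conjI allI ballI impI)
    show "novak_order X R \<subseteq> regular_cuts X R \<times> regular_cuts X R \<times> regular_cuts X R"
      unfolding novak_order_def by blast
  next
    fix L1 L2 L3 assume "(L1, L2, L3) \<in> novak_order X R"
    then obtain p q r where pqr: "L1 = trace_cut p" "L2 = trace_cut q" "L3 = trace_cut r"
      "(p, q, r) \<in> S" "L1 \<noteq> L2" "L2 \<noteq> L3" "L1 \<noteq> L3" using N by blast
    then show "(L2, L3, L1) \<in> novak_order X R"
      using novak_order_trace_cutI[of q r p] circ_cyclic[OF circ_Y] by simp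
    show "(L3, L2, L1) \<notin> novak_order X R"
      using novak_order_trace_cutD[of r q p] pqr circ_in_carrier[OF circ_Y pqr(4)]
        circ_asym[OF circ_Y pqr(4)] by blast
  next
    fix L1 L2 L3 L4
    assume "(L1, L2, L3) \<in> novak_order X R \<and> (L1, L3, L4) \<in> novak_order X R"
    then obtain L: "(L1, L2, L3) \<in> novak_order X R" "(L1, L3, L4) \<in> novak_order X R" by blast
    obtain p q r where pqr: "L1 = trace_cut p" "L2 = trace_cut q" "L3 = trace_cut r"
      "(p, q, r) \<in> S" "L1 \<noteq> L2" "L2 \<noteq> L3" "L1 \<noteq> L3" using N[OF L(1)] by blast
    have Y: "p \<in> Y" "q \<in> Y" "r \<in> Y" using circ_in_carrier[OF circ_Y pqr(4)] by auto
    \<comment> \<open>Only \<open>t\<close> is kept from the second triple;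
      \<open>novak_order_trace_cutD\<close> relates it to the representatives \<open>p\<close> and
      \<open>r\<close> already chosen.\<close>
    obtain t where t: "L4 = trace_cut t" "t \<in> Y" "L3 \<noteq> L4" "L1 \<noteq> L4"
      using N[OF L(2)] circ_in_carrier[OF circ_Y] by blast
    have prt: "(p, r, t) \<in> S" using novak_order_trace_cutD[OF Y(1,3) t(2)] L(2) pqr t by simp
    \<comment> \<open>Otherwise \<open>q\<close> would also represent \<open>L4\<close>, giving
      \<open>(p, r, q)\<close> against \<open>(p, q, r)\<close>.\<close>
    have "L2 \<noteq> L4"
    proof
      assume "L2 = L4"
      then have "(p, r, q) \<in> S" using novak_order_trace_cutD[OF Y(1,3,2)] L(2) pqr t by simp
      then show False
        using circ_asym[OF circ_Y pqr(4)] circ_cyclic[OF circ_Y] by blast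
    qed
    then show "(L1, L2, L4) \<in> novak_order X R"
      using novak_order_trace_cutI[of p q t] circ_trans[OF circ_Y pqr(4) prt] pqr t by simp
  next
    fix L1 L2 L3 assume L: "L1 \<in> regular_cuts X R" "L2 \<in> regular_cuts X R" "L3 \<in> regular_cuts X R"
      "L1 \<noteq> L2 \<and> L2 \<noteq> L3 \<and> L1 \<noteq> L3"
    then obtain p q r where pqr: "p \<in> Y" "q \<in> Y" "r \<in> Y"
      "L1 = trace_cut p" "L2 = trace_cut q" "L3 = trace_cut r" using carrier by meson
    then have "(p, q, r) \<in> S \<or> (p, r, q) \<in> S" using circ_total[OF circ_Y, of p q r] L(4) by blast
    then show "(L1, L2, L3) \<in> novak_order X R \<or> (L1, L3, L2) \<in> novak_order X R"
      using novak_order_trace_cutI L(4) pqr by metis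
  qed
qed

section \<open>The COP property and continuity of \<open>trace_cut\<close>\<close>

lemma trace_cut_cop: "cop_map Y S (regular_cuts X R) (novak_order X R) trace_cut"
  unfolding cop_map_def
proof (intro conjI allI ballI impI)
  show "trace_cut \<in> Y \<rightarrow> regular_cuts X R" using trace_cut_regular by blast
  show "(trace_cut a, trace_cut b, trace_cut c) \<in> novak_order X R"
    if "(a, b, c) \<in> S \<and> trace_cut a \<noteq> trace_cut b \<and> trace_cut b \<noteq> trace_cut c \<and>
      trace_cut a \<noteq> trace_cut c" for a b c
    using novak_order_trace_cutI that by blast
next
  fix p q assume pq: "p \<in> Y" "q \<in> Y" "trace_cut p = trace_cut q"
  show "trace_cut constant_on circ_closed_interval S p q \<or>
    trace_cut constant_on circ_closed_interval S q p"
  proof (cases "p = q")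
    case True
    then show ?thesis by (simp add: circ_closed_interval_self[OF circ_Y] constant_on_def)
  next
    case False
    then have "trace_ico p q = {} \<or> trace_ico q p = {}"
      using trace_cut_eqD[OF pq(1,2)] pq(3) by simp
    then show ?thesis
    proof
      assume "trace_ico p q = {}"
      from trace_cut_constant[OF pq(1,2) this] show ?thesis by (auto simp: constant_on_def)
    next
      assume "trace_ico q p = {}"
      from trace_cut_constant[OF pq(2,1) this] show ?thesis by (auto simp: constant_on_def)
    qed
  qed
qed

text \<open>By density, a point of the fibre of \<open>p\<close> other than \<open>p\<close> is adjacent to \<open>p\<close>.\<close>

lemma finite_fibre_trace_cut:
  assumes p: "p \<in> Y"
  shows "finite {z \<in> Y. trace_cut z = trace_cut p}"
proof -
  \<comment> \<open>Successors and predecessors of \<open>p\<close>. Each set has at most one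
    member, since of two candidates one would lie between \<open>p\<close> and the other.\<close>
  let ?Z = "{z \<in> Y. z \<noteq> p \<and> circ_open_interval S p z = {}}"
  let ?W = "{z \<in> Y. z \<noteq> p \<and> circ_open_interval S z p = {}}"
  have adj: "circ_open_interval S u v = {}" if "trace_ico u v = {}" for u v
    using dense_interval[of u _ v] that by (auto simp: trace_ico_def circ_open_interval_def)
  have fin: "finite Z" if "\<And>u v. u \<in> Z \<Longrightarrow> v \<in> Z \<Longrightarrow> u = v" for Z :: "'b set"
  proof (cases "Z = {}")
    case False
    then obtain u where "u \<in> Z" by blast
    then have "Z \<subseteq> {u}" using that by blast
    then show ?thesis by (rule finite_subset) simp
  qed simp
  have "{z \<in> Y. trace_cut z = trace_cut p} \<subseteq> insert p (?Z \<union> ?W)"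
    using trace_cut_eqD[OF p] adj by fastforce
  moreover have "u = v" if "u \<in> ?Z" "v \<in> ?Z" for u v
  proof (rule ccontr)
    assume "u \<noteq> v"
    then show False
      using that circ_total[OF circ_Y p, of u v] by (auto simp: circ_open_interval_def)
  qed
  then have "finite ?Z" by (rule fin)
  moreover have "u = v" if "u \<in> ?W" "v \<in> ?W" for u v
  proof (rule ccontr)
    assume "u \<noteq> v"
    then have "(p, u, v) \<in> S \<or> (p, v, u) \<in> S"
      using that circ_total[OF circ_Y p, of u v] by auto
    then have "(u, v, p) \<in> S \<or> (v, u, p) \<in> S" using circ_cyclic[OF circ_Y] by blast
    then show False using that by (auto simp: circ_open_interval_def)
  qed
  then have "finite ?W" by (rule fin)
  ultimately show ?thesis using finite_subset[of _ "insert p (?Z \<union> ?W)"] by blast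
qed

lemma closedin_fibre_trace_cut:
  "p \<in> Y \<Longrightarrow> closedin (interval_topology Y S) {z \<in> Y. trace_cut z = trace_cut p}"
  using closedin_interval_topology_finite[OF circ_Y finite_fibre_trace_cut] by simp

text \<open>The preimage of a basic open set is an open arc of \<open>Y\<close> with the fibres over
  its ends removed, or the complement of one fibre if the ends agree. Whole fibres must go, because
  a neighbour of an end can induce the same cut; being finite, they are closed.\<close>

lemma continuous_trace_cut:
  assumes ne: "X \<noteq> {}"
  shows "continuous_map (interval_topology Y S)
    (interval_topology (regular_cuts X R) (novak_order X R)) trace_cut"
proof -
  let ?N = "novak_order X R" and ?Q = "regular_cuts X R" and ?T = "interval_topology Y S"
  note circ_Q = circular_order_on_novak_order[OF ne]
  have "openin ?T (trace_cut -` (?Q - circ_closed_interval ?N L1 L2) \<inter> Y)"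
    if L: "L1 \<in> ?Q" "L2 \<in> ?Q" for L1 L2
  proof -
    obtain p q where pq: "p \<in> Y" "q \<in> Y" "L1 = trace_cut p" "L2 = trace_cut q"
      using L trace_cut_surj[OF ne] by (metis imageE)
    define fib where "fib p = {z \<in> Y. trace_cut z = trace_cut p}" for p
    have opn: "openin ?T (Y - fib p)" "openin ?T (Y - fib q)"
      using closedin_fibre_trace_cut pq openin_closedin_eq unfolding fib_def closedin_def by auto
    show ?thesis
    proof (cases "L1 = L2")
      case True
      then have "trace_cut -` (?Q - circ_closed_interval ?N L1 L2) \<inter> Y = Y - fib p"
        using trace_cut_regular pq by (auto simp: circ_closed_interval_self[OF circ_Q] fib_def)
      then show ?thesis using opn by simp
    next
      case False
      have mem: "trace_cut y \<in> circ_open_interval ?N L2 L1 \<longleftrightarrow>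
          y \<in> circ_open_interval S q p \<and> y \<notin> fib p \<and> y \<notin> fib q" if y: "y \<in> Y" for y
        using novak_order_trace_cutI[of q y p] novak_order_trace_cutD[OF pq(2) y pq(1)] False pq y
          circ_distinct[OF circ_Q, of L2 "trace_cut y" L1]
        by (auto simp: circ_open_interval_def fib_def)
      have "trace_cut -` (?Q - circ_closed_interval ?N L1 L2) \<inter> Y =
          circ_open_interval S q p \<inter> (Y - fib p) \<inter> (Y - fib q)"
        unfolding compl_circ_closed_interval[OF circ_Q L(2,1) False[symmetric]]
        using mem circ_in_carrier[OF circ_Y] by (auto simp: circ_open_interval_def)
      moreover have "openin ?T (circ_open_interval S q p)"
        by (rule openin_circ_open_interval[OF circ_Y]) (use pq False in auto)
      ultimately show ?thesis using opn by (simp add: openin_Int)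
    qed
  qed
  moreover have "trace_cut -` ?Q \<inter> Y = Y" using trace_cut_regular by blast
  ultimately show ?thesis
    unfolding interval_topology_def[of ?Q]
    by (intro continuous_on_generated_topo)
      (use trace_cut_regular openin_topspace[of ?T] in \<open>auto simp: interval_base_def\<close>)
qed

end

section \<open>Existence and uniqueness of the map onto the regular completion\<close>

text \<open>The other clauses speak only of values on \<open>Y\<close>; \<open>extensional Y\<close>
  fixes the values elsewhere, so that uniqueness is that of a map defined on
  \<open>Y\<close>.\<close>

theorem theorem8p8:
  fixes X :: "'a set" and R :: "('a \<times> 'a \<times> 'a) set"
    and Y :: "'b set" and RY :: "('b \<times> 'b \<times> 'b) set"
    and iY :: "'a \<Rightarrow> 'b"
  assumes "X \<noteq> {}"
    and "circular_order_on X R"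
    and "proper_co_compactification X R Y RY iY"
  shows "\<exists>!\<Psi>. \<Psi> \<in> extensional Y \<and>
           continuous_map (interval_topology Y RY)
             (interval_topology (regular_cuts X R) (novak_order X R)) \<Psi> \<and>
           cop_map Y RY (regular_cuts X R) (novak_order X R) \<Psi> \<and>
           \<Psi> ` Y = regular_cuts X R \<and>
           (\<forall>x\<in>X. \<Psi> (iY x) = lower_point_cut X R x)"
proof -
  interpret proper_compactification X R Y RY iY by unfold_locales (use assms in auto)
  let ?T = "interval_topology Y RY" and ?Q = "interval_topology (regular_cuts X R) (novak_order X R)"
  have eq: "restrict trace_cut Y y = trace_cut y" if "y \<in> Y" for y using that by simp
  show ?thesis
  proof (rule ex1I[of _ "restrict trace_cut Y"], intro conjI ballI)
    show "restrict trace_cut Y \<in> extensional Y" by simp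
    show "continuous_map ?T ?Q (restrict trace_cut Y)"
      by (rule continuous_map_eq[OF continuous_trace_cut[OF assms(1)]]) simp
    show "restrict trace_cut Y ` Y = regular_cuts X R"
      using trace_cut_surj[OF assms(1)] by simp
    show "restrict trace_cut Y (iY x) = lower_point_cut X R x" if "x \<in> X" for x
      using that image_in trace_cut_image by simp
    show "cop_map Y RY (regular_cuts X R) (novak_order X R) (restrict trace_cut Y)"
      unfolding cop_map_def
    proof (intro conjI allI ballI impI)
      show "restrict trace_cut Y \<in> Y \<rightarrow> regular_cuts X R" using trace_cut_regular by simp
    next
      fix a b c
      assume abc: "(a, b, c) \<in> RY \<and> restrict trace_cut Y a \<noteq> restrict trace_cut Y b \<and>
        restrict trace_cut Y b \<noteq> restrict trace_cut Y c \<and> restrict trace_cut Y a \<noteq> restrict trace_cut Y c"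
      then have "a \<in> Y" "b \<in> Y" "c \<in> Y" using circ_in_carrier[OF circ_Y] by blast+
      then show "(restrict trace_cut Y a, restrict trace_cut Y b, restrict trace_cut Y c) \<in> novak_order X R"
        using novak_order_trace_cutI[of a b c] abc by simp
    next
      fix p q assume pq: "p \<in> Y" "q \<in> Y" "restrict trace_cut Y p = restrict trace_cut Y q"
      \<comment> \<open>Intervals with ends in \<open>Y\<close> stay in \<open>Y\<close>, where
        restriction changes no value.\<close>
      have "circ_closed_interval RY u v \<subseteq> Y" if "u \<in> Y" "v \<in> Y" for u v
        using that circ_in_carrier[OF circ_Y]
        by (auto simp: circ_closed_interval_def circ_open_interval_def)
      then have "restrict trace_cut Y constant_on circ_closed_interval RY u v"
        if "u \<in> Y" "v \<in> Y" "trace_cut constant_on circ_closed_interval RY u v" for u v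
        using that unfolding constant_on_def by (metis eq subsetD)
      then show "restrict trace_cut Y constant_on circ_closed_interval RY p q \<or>
        restrict trace_cut Y constant_on circ_closed_interval RY q p"
        using trace_cut_cop pq unfolding cop_map_def by (metis eq)
    qed
  next
    fix \<Psi> assume \<Psi>: "\<Psi> \<in> extensional Y \<and> continuous_map ?T ?Q \<Psi> \<and>
      cop_map Y RY (regular_cuts X R) (novak_order X R) \<Psi> \<and> \<Psi> ` Y = regular_cuts X R \<and>
      (\<forall>x\<in>X. \<Psi> (iY x) = lower_point_cut X R x)"
    have "\<Psi> y = trace_cut y" if "y \<in> Y" for y
    proof (rule forall_in_closure_of_eq[of y ?T "iY ` X" ?Q])
      show "y \<in> ?T closure_of (iY ` X)" using that closure_image by simp
      show "Hausdorff_space ?Q"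
        by (rule Hausdorff_interval_topology[OF circular_order_on_novak_order[OF assms(1)]])
      show "continuous_map ?T ?Q \<Psi>" using \<Psi> by blast
      show "continuous_map ?T ?Q trace_cut" by (rule continuous_trace_cut[OF assms(1)])
      show "\<Psi> z = trace_cut z" if "z \<in> iY ` X" for z
        using that \<Psi> trace_cut_image by auto
    qed
    then show "\<Psi> = restrict trace_cut Y"
      using \<Psi> by (auto intro!: extensionalityI[of _ Y])
  qed
qed

end
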